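(* There is an algorithm for \textsc{Distinct Kemeny Ranking Aggregation} that, on an instance $(\mathcal{C},\Pi,k,r)$, runs in time $O^*(2^{k})$; in particular the problem is fixed-parameter tractable parameterized by $k$. Consequently, there is an algorithm for \textsc{Distinct OPT Kemeny Ranking Aggregation} that, on an instance $(\mathcal{C},\Pi,r)$, runs in time $O^*(2^{k_{OPT}(\Pi)})$.
   Context: Let $\mathcal{C}$ be a set of candidates and $\Pi$ a multiset of rankings (complete linear orders) of $\mathcal{C}$. The Kendall-Tau distance $d_{KT}(\pi,\sigma)$ is the number of pairs of candidates that two rankings order differently. The Kemeny score of a ranking $Q$ is $\mathrm{Kemeny}_\Pi(Q)=\sum_{\pi\in\Pi} d_{KT}(Q,\pi)$; a Kemeny ranking minimizes it, and the minimum is $k_{OPT}(\Pi)$. $K(\Pi)$ denotes the set of Kemeny rankings and $K(\Pi,k)$ the set of rankings of Kemeny score at most $k$. A ranking respects the unanimity order of $\Pi$ if it places $x$ before $y$ whenever all rankings in $\Pi$ do. \textsc{Distinct Kemeny Ranking Aggregation}: given $(\mathcal{C},\Pi,k,r)$, output $\min\{r,|K(\Pi,k)|\}$ distinct rankings, each of Kemeny score at most $k$ and respecting the unanimity order. \textsc{Distinct OPT Kemeny Ranking Aggregation}: given $(\mathcal{C},\Pi,r)$, output $\min\{r,|K(\Pi)|\}$ distinct Kemeny rankings. $O^*(g)$ denotes $O(g\cdot \mathrm{poly}(\text{input size}))$.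
   Formalization: The number of rankings to output is min of r and the number of rankings in K(Π,k) that respect the unanimity order (with all of K(Π,k) counted, some instances have no valid output), and Π is assumed nonempty (for empty Π the bound for the OPT problem fails). *)

theory Defs
  imports "HOL-Library.Multiset" "HOL-Computational_Algebra.Polynomial"
begin

section \<open>Kemeny rankings\<close>

text \<open>A ranking of \<open>C\<close> is a relation \<open>R\<close> with \<open>linear_order_on C R\<close>, where \<open>(x, y) \<in> R\<close> means
  that \<open>x\<close> is placed before \<open>y\<close> or \<open>x = y\<close>.\<close>

definition before :: "'a rel \<Rightarrow> 'a \<Rightarrow> 'a \<Rightarrow> bool" where
  "before R x y \<longleftrightarrow> x \<noteq> y \<and> (x, y) \<in> R"

definition kt_dist :: "'a rel \<Rightarrow> 'a rel \<Rightarrow> nat" where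
  "kt_dist R S = card {{x, y} | x y. before R x y \<and> before S y x}"

definition kemeny_score :: "'a rel multiset \<Rightarrow> 'a rel \<Rightarrow> nat" where
  "kemeny_score \<Pi> Q = (\<Sum>\<pi>\<in>#\<Pi>. kt_dist Q \<pi>)"

definition kemeny_rankings :: "'a set \<Rightarrow> 'a rel multiset \<Rightarrow> 'a rel set" where
  "kemeny_rankings C \<Pi> = {Q. is_arg_min (kemeny_score \<Pi>) (linear_order_on C) Q}"

definition k_opt :: "'a set \<Rightarrow> 'a rel multiset \<Rightarrow> nat" where
  "k_opt C \<Pi> = Min (kemeny_score \<Pi> ` {Q. linear_order_on C Q})"

definition kemeny_at_most :: "'a set \<Rightarrow> 'a rel multiset \<Rightarrow> nat \<Rightarrow> 'a rel set" where
  "kemeny_at_most C \<Pi> k = {Q. linear_order_on C Q \<and> kemeny_score \<Pi> Q \<le> k}"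

definition respects_unanimity :: "'a set \<Rightarrow> 'a rel multiset \<Rightarrow> 'a rel \<Rightarrow> bool" where
  "respects_unanimity C \<Pi> Q \<longleftrightarrow>
     (\<forall>x\<in>C. \<forall>y\<in>C. (\<forall>\<pi>\<in>#\<Pi>. before \<pi> x y) \<longrightarrow> before Q x y)"

definition profile :: "'a set \<Rightarrow> 'a rel multiset \<Rightarrow> bool" where
  "profile C \<Pi> \<longleftrightarrow> finite C \<and> \<Pi> \<noteq> {#} \<and> (\<forall>\<pi>\<in>#\<Pi>. linear_order_on C \<pi>)"

text \<open>The rankings to be counted are those of score at most \<open>k\<close> that respect the unanimity order.
  Counting all of \<open>kemeny_at_most C \<Pi> k\<close> instead would leave instances without any valid output:
  for two candidates, a single vote, \<open>k = 1\<close> and \<open>r = 2\<close>, two rankings have score at most 1,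
  but only one respects unanimity. The lemma below shows that the two readings agree
  on every instance on which the latter one has a valid output.\<close>

definition distinct_kemeny ::
    "'a set \<Rightarrow> 'a rel multiset \<Rightarrow> nat \<Rightarrow> nat \<Rightarrow> 'a rel list \<Rightarrow> bool" where
  "distinct_kemeny C \<Pi> k r Rs \<longleftrightarrow>
     distinct Rs \<and>
     length Rs = min r (card {Q \<in> kemeny_at_most C \<Pi> k. respects_unanimity C \<Pi> Q}) \<and>
     (\<forall>R\<in>set Rs. R \<in> kemeny_at_most C \<Pi> k \<and> respects_unanimity C \<Pi> R)"

definition distinct_kemeny_all ::
    "'a set \<Rightarrow> 'a rel multiset \<Rightarrow> nat \<Rightarrow> nat \<Rightarrow> 'a rel list \<Rightarrow> bool" where
  "distinct_kemeny_all C \<Pi> k r Rs \<longleftrightarrow>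
     distinct Rs \<and>
     length Rs = min r (card (kemeny_at_most C \<Pi> k)) \<and>
     (\<forall>R\<in>set Rs. R \<in> kemeny_at_most C \<Pi> k \<and> respects_unanimity C \<Pi> R)"

lemma distinct_kemeny_iff_all:
  assumes fin: "finite C" and ex: "distinct_kemeny_all C \<Pi> k r Rs'"
  shows "distinct_kemeny C \<Pi> k r Rs \<longleftrightarrow> distinct_kemeny_all C \<Pi> k r Rs"
proof -
  let ?K = "kemeny_at_most C \<Pi> k" and ?U = "{Q \<in> kemeny_at_most C \<Pi> k. respects_unanimity C \<Pi> Q}"
  have "?K \<subseteq> Pow (C \<times> C)"
    by (auto simp: kemeny_at_most_def order_on_defs)
  then have K: "finite ?K"
    by (rule finite_subset) (simp add: fin)
  have "card (set Rs') \<le> card ?U"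
    using K ex by (intro card_mono) (auto simp: distinct_kemeny_all_def)
  then have "min r (card ?K) \<le> card ?U"
    using ex by (auto simp: distinct_kemeny_all_def distinct_card)
  moreover have "card ?U \<le> card ?K"
    using K by (intro card_mono) auto
  ultimately have "min r (card ?U) = min r (card ?K)"
    by linarith
  then show ?thesis
    by (simp add: distinct_kemeny_def distinct_kemeny_all_def)
qed

definition distinct_opt_kemeny ::
    "'a set \<Rightarrow> 'a rel multiset \<Rightarrow> nat \<Rightarrow> 'a rel list \<Rightarrow> bool" where
  "distinct_opt_kemeny C \<Pi> r Rs \<longleftrightarrow>
     distinct Rs \<and>
     length Rs = min r (card (kemeny_rankings C \<Pi>)) \<and>
     set Rs \<subseteq> kemeny_rankings C \<Pi>"


section \<open>Machine model\<close>

text \<open>Programs are systems of mutually recursive first-order function definitions over binary trees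
  (the data type and basic operations of Jones, Computability and Complexity, 1997).
  An environment lists the arguments of the current call. Every evaluation step costs 1 and is a
  constant number of pointer operations: there is no unit-cost arithmetic and no unit-cost
  comparison of trees, so the step count is, up to a constant factor depending
  on the program, a running time on a random access machine.\<close>

datatype tree = Atom | Pair tree tree

datatype expr =
    EVar nat
  | EAtom
  | EPair expr expr
  | EHd expr
  | ETl expr
  | EIf expr expr expr
  | ECall nat "expr list"

type_synonym prog = "expr list"

fun thd :: "tree \<Rightarrow> tree" where
  "thd Atom = Atom"
| "thd (Pair a b) = a"

fun ttl :: "tree \<Rightarrow> tree" where
  "ttl Atom = Atom"
| "ttl (Pair a b) = b"

inductive evaluates :: "prog \<Rightarrow> tree list \<Rightarrow> expr \<Rightarrow> tree \<Rightarrow> nat \<Rightarrow> bool"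
  and evaluates_list :: "prog \<Rightarrow> tree list \<Rightarrow> expr list \<Rightarrow> tree list \<Rightarrow> nat \<Rightarrow> bool"
  for P :: prog where
  ev_var: "i < length env \<Longrightarrow> evaluates P env (EVar i) (env ! i) 1"
| ev_atom: "evaluates P env EAtom Atom 1"
| ev_pair: "evaluates P env e1 v1 t1 \<Longrightarrow> evaluates P env e2 v2 t2 \<Longrightarrow>
    evaluates P env (EPair e1 e2) (Pair v1 v2) (t1 + t2 + 1)"
| ev_hd: "evaluates P env e v t \<Longrightarrow> evaluates P env (EHd e) (thd v) (t + 1)"
| ev_tl: "evaluates P env e v t \<Longrightarrow> evaluates P env (ETl e) (ttl v) (t + 1)"
| ev_if_true: "evaluates P env b u t0 \<Longrightarrow> u \<noteq> Atom \<Longrightarrow> evaluates P env e1 v t \<Longrightarrow>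
    evaluates P env (EIf b e1 e2) v (t0 + t + 1)"
| ev_if_false: "evaluates P env b Atom t0 \<Longrightarrow> evaluates P env e2 v t \<Longrightarrow>
    evaluates P env (EIf b e1 e2) v (t0 + t + 1)"
| ev_call: "evaluates_list P env es vs t0 \<Longrightarrow> f < length P \<Longrightarrow> evaluates P vs (P ! f) v t \<Longrightarrow>
    evaluates P env (ECall f es) v (t0 + t + 1)"
| ev_nil: "evaluates_list P env [] [] 0"
| ev_cons: "evaluates P env e v t \<Longrightarrow> evaluates_list P env es vs t' \<Longrightarrow>
    evaluates_list P env (e # es) (v # vs) (t + t')"

lemma evaluates_deterministic:
  "evaluates P env e v t \<Longrightarrow> evaluates P env e v' t' \<Longrightarrow> v' = v \<and> t' = t"
  "evaluates_list P env es vs t \<Longrightarrow> evaluates_list P env es vs' t' \<Longrightarrow> vs' = vs \<and> t' = t"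
proof (induction arbitrary: v' t' and vs' t' rule: evaluates_evaluates_list.inducts)
  case (ev_var i env)
  from ev_var.prems show ?case by cases auto
next
  case (ev_atom env)
  from ev_atom.prems show ?case by cases auto
next
  case (ev_pair env e1 v1 t1 e2 v2 t2)
  from ev_pair.prems show ?case using ev_pair.IH by cases blast
next
  case (ev_hd env e v t)
  from ev_hd.prems show ?case using ev_hd.IH by cases blast
next
  case (ev_tl env e v t)
  from ev_tl.prems show ?case using ev_tl.IH by cases blast
next
  case (ev_if_true env b u t0 e1 v t e2)
  from ev_if_true.prems show ?case using ev_if_true.IH ev_if_true.hyps by cases blast+
next
  case (ev_if_false env b t0 e2 v t e1)
  from ev_if_false.prems show ?case using ev_if_false.IH by cases blast+
next
  case (ev_call env es vs t0 f v t)
  from ev_call.prems show ?case using ev_call.IH by cases blast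
next
  case (ev_nil env)
  from ev_nil.prems show ?case by cases auto
next
  case (ev_cons env e v t es vs t')
  from ev_cons.prems show ?case using ev_cons.IH by cases blast
qed

definition runs :: "prog \<Rightarrow> tree \<Rightarrow> tree \<Rightarrow> nat \<Rightarrow> bool" where
  "runs P x y t \<longleftrightarrow> evaluates P [x] (ECall 0 [EVar 0]) y t"

text \<open>Numbers are encoded in binary, least significant bit first.\<close>

fun enc_nat :: "nat \<Rightarrow> tree" where
  "enc_nat n =
     (if n = 0 then Atom
      else Pair (if odd n then Pair Atom Atom else Atom) (enc_nat (n div 2)))"

declare enc_nat.simps [simp del]

fun enc_list :: "('a \<Rightarrow> tree) \<Rightarrow> 'a list \<Rightarrow> tree" where
  "enc_list f [] = Atom"
| "enc_list f (x # xs) = Pair (f x) (enc_list f xs)"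


section \<open>Running times\<close>

text \<open>A computational problem is given by two relations: \<open>inp i x\<close> holds if the tree \<open>x\<close> is an
  encoding of the instance \<open>i\<close>, and \<open>sol i y\<close> holds if \<open>y\<close> encodes a correct output for \<open>i\<close>.
  The input size is the number of inner nodes of \<open>x\<close>. The constant hidden in
  \<open>O(g \<cdot> poly)\<close> is absorbed by the polynomial \<open>q\<close>.\<close>

definition solves_in_O_star ::
    "prog \<Rightarrow> ('i \<Rightarrow> tree \<Rightarrow> bool) \<Rightarrow> ('i \<Rightarrow> tree \<Rightarrow> bool) \<Rightarrow> ('i \<Rightarrow> nat) \<Rightarrow> bool" where
  "solves_in_O_star P inp sol g \<longleftrightarrow>
     (\<exists>q :: nat poly. \<forall>i x. inp i x \<longrightarrow>
        (\<exists>y t. runs P x y t \<and> sol i y \<and> t \<le> g i * poly q (size x)))"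

definition computable :: "(nat \<Rightarrow> nat) \<Rightarrow> bool" where
  "computable f \<longleftrightarrow> (\<exists>P. \<forall>n. \<exists>t. runs P (enc_nat n) (enc_nat (f n)) t)"

definition fixed_parameter_tractable ::
    "('i \<Rightarrow> tree \<Rightarrow> bool) \<Rightarrow> ('i \<Rightarrow> tree \<Rightarrow> bool) \<Rightarrow> ('i \<Rightarrow> nat) \<Rightarrow> bool" where
  "fixed_parameter_tractable inp sol \<kappa> \<longleftrightarrow>
     (\<exists>P f. computable f \<and> solves_in_O_star P inp sol (\<lambda>i. f (\<kappa> i)))"


section \<open>The two problems\<close>

text \<open>Candidates are named by natural numbers. In inputs and outputs a ranking is
  written as the list of its candidates, first candidate first.\<close>

definition list_order :: "'a list \<Rightarrow> 'a rel" where
  "list_order xs = {(xs ! i, xs ! j) | i j. i \<le> j \<and> j < length xs}"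

definition lists_ranking :: "nat set \<Rightarrow> nat list \<Rightarrow> bool" where
  "lists_ranking C xs \<longleftrightarrow> distinct xs \<and> set xs = C"

definition lists_profile ::
    "nat set \<Rightarrow> nat rel multiset \<Rightarrow> nat list \<Rightarrow> nat list list \<Rightarrow> bool" where
  "lists_profile C \<Pi> cs vs \<longleftrightarrow>
     distinct cs \<and> set cs = C \<and> (\<forall>v\<in>set vs. lists_ranking C v) \<and> mset (map list_order vs) = \<Pi>"

definition output_rankings :: "nat set \<Rightarrow> nat rel list \<Rightarrow> tree \<Rightarrow> bool" where
  "output_rankings C Rs y \<longleftrightarrow>
     (\<exists>ys. (\<forall>v\<in>set ys. lists_ranking C v) \<and> Rs = map list_order ys \<and>
           y = enc_list (enc_list enc_nat) ys)"

fun distinct_kemeny_input :: "nat set \<times> nat rel multiset \<times> nat \<times> nat \<Rightarrow> tree \<Rightarrow> bool" where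
  "distinct_kemeny_input (C, \<Pi>, k, r) x \<longleftrightarrow>
     profile C \<Pi> \<and>
     (\<exists>cs vs. lists_profile C \<Pi> cs vs \<and>
        x = enc_list (\<lambda>z. z)
              [enc_list enc_nat cs, enc_list (enc_list enc_nat) vs, enc_nat k, enc_nat r])"

fun distinct_kemeny_output :: "nat set \<times> nat rel multiset \<times> nat \<times> nat \<Rightarrow> tree \<Rightarrow> bool" where
  "distinct_kemeny_output (C, \<Pi>, k, r) y \<longleftrightarrow>
     (\<exists>Rs. distinct_kemeny C \<Pi> k r Rs \<and> output_rankings C Rs y)"

fun distinct_opt_kemeny_input :: "nat set \<times> nat rel multiset \<times> nat \<Rightarrow> tree \<Rightarrow> bool" where
  "distinct_opt_kemeny_input (C, \<Pi>, r) x \<longleftrightarrow>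
     profile C \<Pi> \<and>
     (\<exists>cs vs. lists_profile C \<Pi> cs vs \<and>
        x = enc_list (\<lambda>z. z)
              [enc_list enc_nat cs, enc_list (enc_list enc_nat) vs, enc_nat r])"

fun distinct_opt_kemeny_output :: "nat set \<times> nat rel multiset \<times> nat \<Rightarrow> tree \<Rightarrow> bool" where
  "distinct_opt_kemeny_output (C, \<Pi>, r) y \<longleftrightarrow>
     (\<exists>Rs. distinct_opt_kemeny C \<Pi> r Rs \<and> output_rankings C Rs y)"

end

theory Submission
  imports Defs
begin

text \<open>Rankings are enumerated by inserting the candidates one after the other, keeping only those
  partial rankings that respect unanimity and have score at most \<open>k\<close> on the candidates inserted so
  far. A pair that is not ordered unanimously costs at least 1 in either order, and for a unanimous
  pair there is no choice, so giving a partial ranking the weight \<open>2\<^bsup>-score\<^esup>\<close> keeps the total weight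
  at most 1. Hence at most \<open>2\<^sup>k\<close> partial rankings are ever stored.

  For the second problem the enumeration is run for \<open>k = 0, 1, 2, \<dots>\<close> until it finds a ranking; the
  times form a geometric series. Nothing is lost by the restriction to unanimity, since
  exchanging two candidates that are ordered against a unanimous vote lowers the score.\<close>

section \<open>Evaluation as a function\<close>

text \<open>Early pruning is sound because both filters are hereditary: deleting a candidate keeps
  the remaining pairs supported and cannot raise the score, so the restriction of a final ranking to
  the candidates inserted so far has survived. The weight is tracked instead of the number of
  rankings because a single insertion may turn one ranking into many; these compensate by larger
  scores.

  Since \<open>k\<close> is given in binary, it can be exponential in the input size. A unary budget
  is still affordable, as \<open>k < 2 ^ k\<close>, and it turns the arithmetic on scores into
  walking down a list, at a cost independent of \<open>k\<close>. In contrast, \<open>r\<close> is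
  not bounded by any factor of the running time and therefore stays binary.\<close>

text \<open>A functional form of \<open>evaluates\<close>, well defined by
  \<open>evaluates_deterministic\<close>, with which the simplifier can run programs and add up
  their steps. \<open>None\<close> stands for divergence and for stuck evaluation.\<close>

definition eval :: "prog \<Rightarrow> tree list \<Rightarrow> expr \<Rightarrow> (tree \<times> nat) option" where
  "eval P env e =
     (if \<exists>v t. evaluates P env e v t then Some (SOME (v, t). evaluates P env e v t) else None)"

definition eval_list :: "prog \<Rightarrow> tree list \<Rightarrow> expr list \<Rightarrow> (tree list \<times> nat) option" where
  "eval_list P env es =
     (if \<exists>vs t. evaluates_list P env es vs t then Some (SOME (vs, t). evaluates_list P env es vs t)
      else None)"

text \<open>The bind operator of the monad of partial computations with a step counter.\<close>

fun and_then :: "('a \<times> nat) option \<Rightarrow> ('a \<Rightarrow> ('b \<times> nat) option) \<Rightarrow> ('b \<times> nat) option" where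
  "and_then None f = None"
| "and_then (Some (v, t)) f = (case f v of None \<Rightarrow> None | Some (w, s) \<Rightarrow> Some (w, t + s))"

text \<open>Symbolic execution stops here: \<open>eval_simps\<close> reduces \<open>eval\<close> to
  \<open>call\<close>. Bodies are unfolded one at a time by \<open>call_with_main\<close>, and the
  recursive calls that appear are left to the induction hypotheses.\<close>

definition call :: "prog \<Rightarrow> nat \<Rightarrow> tree list \<Rightarrow> (tree \<times> nat) option" where
  "call P f vs = (if f < length P then eval P vs (P ! f) else None)"

lemma eval_eq_Some_iff: "eval P env e = Some (v, t) \<longleftrightarrow> evaluates P env e v t"
proof
  assume "eval P env e = Some (v, t)"
  then have ex: "\<exists>p. case p of (v, t) \<Rightarrow> evaluates P env e v t"
    and "(v, t) = (SOME (v, t). evaluates P env e v t)"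
    by (auto simp: eval_def split: if_splits)
  then show "evaluates P env e v t" using someI_ex[OF ex] by (metis case_prod_conv)
next
  assume a: "evaluates P env e v t"
  then have "(SOME (v, t). evaluates P env e v t) = (v, t)"
    by (intro some_equality) (auto dest: evaluates_deterministic)
  with a show "eval P env e = Some (v, t)" by (auto simp: eval_def)
qed

lemma eval_list_eq_Some_iff: "eval_list P env es = Some (vs, t) \<longleftrightarrow> evaluates_list P env es vs t"
proof
  assume "eval_list P env es = Some (vs, t)"
  then have ex: "\<exists>p. case p of (vs, t) \<Rightarrow> evaluates_list P env es vs t"
    and "(vs, t) = (SOME (vs, t). evaluates_list P env es vs t)"
    by (auto simp: eval_list_def split: if_splits)
  then show "evaluates_list P env es vs t" using someI_ex[OF ex] by (metis case_prod_conv)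
next
  assume a: "evaluates_list P env es vs t"
  then have "(SOME (vs, t). evaluates_list P env es vs t) = (vs, t)"
    by (intro some_equality) (auto dest: evaluates_deterministic)
  with a show "eval_list P env es = Some (vs, t)" by (auto simp: eval_list_def)
qed

lemma option_pair_eqI:
  "(\<And>v t. x = Some (v, t) \<longleftrightarrow> y = Some (v, t)) \<Longrightarrow> x = y" for x y :: "('a \<times> 'b) option"
  by (cases x; cases y) fastforce+

lemma and_then_eq_Some_iff:
  "and_then x f = Some (w, t) \<longleftrightarrow>
     (\<exists>v t1 t2. x = Some (v, t1) \<and> f v = Some (w, t2) \<and> t = t1 + t2)"
  by (cases "(x, f)" rule: and_then.cases) (auto split: option.splits)

lemma eval_simps [simp]:
  "eval P env (EVar i) = (if i < length env then Some (env ! i, 1) else None)"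
  "eval P env EAtom = Some (Atom, 1)"
  "eval P env (EPair a b) =
     and_then (eval P env a) (\<lambda>v. and_then (eval P env b) (\<lambda>w. Some (Pair v w, 1)))"
  "eval P env (EHd a) = and_then (eval P env a) (\<lambda>v. Some (thd v, 1))"
  "eval P env (ETl a) = and_then (eval P env a) (\<lambda>v. Some (ttl v, 1))"
  "eval P env (EIf a b c) =
     and_then (eval P env a)
       (\<lambda>v. and_then (if v = Atom then eval P env c else eval P env b) (\<lambda>w. Some (w, 1)))"
  "eval P env (ECall f es) =
     and_then (eval_list P env es) (\<lambda>vs. and_then (call P f vs) (\<lambda>w. Some (w, 1)))"
  "eval_list P env [] = Some ([], 0)"
  "eval_list P env (e # es) =
     and_then (eval P env e) (\<lambda>v. and_then (eval_list P env es) (\<lambda>vs. Some (v # vs, 0)))"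
proof -
  note iffs = eval_eq_Some_iff eval_list_eq_Some_iff and_then_eq_Some_iff call_def
    evaluates.simps[of P env "EVar i"] evaluates.simps[of P env EAtom]
    evaluates.simps[of P env "EPair a b"] evaluates.simps[of P env "EHd a"]
    evaluates.simps[of P env "ETl a"]
    evaluates.simps[of P env "ECall f es"] evaluates_list.simps[of P env "[]"]
    evaluates_list.simps[of P env "e # es"]
  show "eval P env (EVar i) = (if i < length env then Some (env ! i, 1) else None)"
    by (rule option_pair_eqI) (auto simp: iffs)
  show "eval P env EAtom = Some (Atom, 1)"
    by (rule option_pair_eqI) (auto simp: iffs)
  show "eval P env (EPair a b) =
      and_then (eval P env a) (\<lambda>v. and_then (eval P env b) (\<lambda>w. Some (Pair v w, 1)))"
    by (rule option_pair_eqI, rule iffI; force simp: iffs)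
  show "eval P env (EHd a) = and_then (eval P env a) (\<lambda>v. Some (thd v, 1))"
    by (rule option_pair_eqI, rule iffI; force simp: iffs)
  show "eval P env (ETl a) = and_then (eval P env a) (\<lambda>v. Some (ttl v, 1))"
    by (rule option_pair_eqI, rule iffI; force simp: iffs)
  show "eval P env (EIf a b c) =
      and_then (eval P env a)
        (\<lambda>v. and_then (if v = Atom then eval P env c else eval P env b) (\<lambda>w. Some (w, 1)))"
  proof (rule option_pair_eqI, rule iffI)
    fix v t
    assume "eval P env (EIf a b c) = Some (v, t)"
    then have "evaluates P env (EIf a b c) v t" by (simp add: eval_eq_Some_iff)
    then show "and_then (eval P env a)
        (\<lambda>v. and_then (if v = Atom then eval P env c else eval P env b) (\<lambda>w. Some (w, 1))) =
        Some (v, t)"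
      by cases (simp_all add: eval_eq_Some_iff[symmetric])
  next
    fix v t
    assume "and_then (eval P env a)
        (\<lambda>v. and_then (if v = Atom then eval P env c else eval P env b) (\<lambda>w. Some (w, 1))) =
        Some (v, t)"
    then show "eval P env (EIf a b c) = Some (v, t)"
      by (auto simp: and_then_eq_Some_iff eval_eq_Some_iff split: if_splits
          intro: ev_if_true[simplified] ev_if_false[simplified])
  qed
  show "eval P env (ECall f es) =
      and_then (eval_list P env es) (\<lambda>vs. and_then (call P f vs) (\<lambda>w. Some (w, 1)))"
    by (cases "f < length P"; rule option_pair_eqI, rule iffI; force simp: iffs)
  show "eval_list P env [] = Some ([], 0)"
    by (rule option_pair_eqI) (auto simp: iffs)
  show "eval_list P env (e # es) =
      and_then (eval P env e) (\<lambda>v. and_then (eval_list P env es) (\<lambda>vs. Some (v # vs, 0)))"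
    by (rule option_pair_eqI, rule iffI; force simp: iffs)
qed

text \<open>The 2 steps are the evaluation of the argument \<open>EVar 0\<close> and the step of
  \<open>ECall\<close> itself.\<close>

lemma runs_iff_call: "runs P x y (t + 2) \<longleftrightarrow> call P 0 [x] = Some (y, t)"
  by (cases "call P 0 [x]") (auto simp: runs_def eval_eq_Some_iff[symmetric])

section \<open>The programs\<close>

text \<open>\<open>ECall i\<close> refers to the entry with index \<open>i\<close> in the list \<open>with_main\<close> below; index 0 is
  the main function of the respective program.

  The programs \<open>pay_\<dots>\<close> check a ranking with a unary budget of initially \<open>k + 1\<close>. Every
  disagreement with a vote takes one unit, where \<open>ttl Atom = Atom\<close> truncates at 0, and an
  unsupported pair takes everything. A ranking is accepted if the remaining budget is positive.\<close>

definition eq_body :: expr where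
  "eq_body =
     EIf (EVar 0)
       (EIf (EVar 1)
          (EIf (ECall 1 [EHd (EVar 0), EHd (EVar 1)]) (ECall 1 [ETl (EVar 0), ETl (EVar 1)]) EAtom)
          EAtom)
       (EIf (EVar 1) EAtom (EPair EAtom EAtom))"

definition bef_body :: expr where
  "bef_body =
     EIf (EVar 0)
       (EIf (ECall 1 [EVar 1, EHd (EVar 0)]) (EPair EAtom EAtom)
          (EIf (ECall 1 [EVar 2, EHd (EVar 0)]) EAtom
             (ECall 2 [ETl (EVar 0), EVar 1, EVar 2])))
       EAtom"

definition supported_body :: expr where
  "supported_body =
     EIf (EVar 0)
       (EIf (ECall 2 [EHd (EVar 0), EVar 1, EVar 2]) (EPair EAtom EAtom)
          (ECall 3 [ETl (EVar 0), EVar 1, EVar 2]))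
       EAtom"

definition pay_pair_body :: expr where
  "pay_pair_body =
     EIf (EVar 0)
       (ECall 4 [ETl (EVar 0), EVar 1, EVar 2,
          EIf (ECall 2 [EHd (EVar 0), EVar 2, EVar 1]) (ETl (EVar 3)) (EVar 3)])
       (EVar 3)"

definition pay_row_body :: expr where
  "pay_row_body =
     EIf (EVar 2)
       (EIf (ECall 3 [EVar 0, EVar 1, EHd (EVar 2)])
          (ECall 5 [EVar 0, EVar 1, ETl (EVar 2),
             ECall 4 [EVar 0, EVar 1, EHd (EVar 2), EVar 3]])
          EAtom)
       (EVar 3)"

definition pay_body :: expr where
  "pay_body =
     EIf (EVar 1)
       (ECall 6 [EVar 0, ETl (EVar 1), ECall 5 [EVar 0, EHd (EVar 1), ETl (EVar 1), EVar 2]])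
       (EVar 2)"

definition rev_append_body :: expr where
  "rev_append_body =
     EIf (EVar 0) (ECall 7 [ETl (EVar 0), EPair (EHd (EVar 0)) (EVar 1)]) (EVar 1)"

definition keep_body :: expr where
  "keep_body = EIf (ECall 6 [EVar 0, EVar 2, EVar 1]) (EPair (EVar 2) (EVar 3)) (EVar 3)"

text \<open>A zipper: argument 3 is the reversed part before the insertion point, argument 4 the
  part after it. The \<open>let\<close> belongs to HOL, not to the programs: \<open>out\<close> is
  copied into both branches, only one of which is evaluated.\<close>

definition inserts_body :: expr where
  "inserts_body =
     (let out = ECall 8 [EVar 0, EVar 1, ECall 7 [EVar 3, EPair (EVar 2) (EVar 4)], EVar 5]
      in EIf (EVar 4)
           (ECall 9 [EVar 0, EVar 1, EVar 2, EPair (EHd (EVar 4)) (EVar 3), ETl (EVar 4), out])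
           out)"

definition extend_body :: expr where
  "extend_body =
     EIf (EVar 3)
       (ECall 10 [EVar 0, EVar 1, EVar 2, ETl (EVar 3),
          ECall 9 [EVar 0, EVar 1, EVar 2, EAtom, EHd (EVar 3), EVar 4]])
       (EVar 4)"

definition enumerate_body :: expr where
  "enumerate_body =
     EIf (EVar 2)
       (ECall 11 [EVar 0, EVar 1, ETl (EVar 2),
          ECall 10 [EVar 0, EVar 1, EHd (EVar 2), EVar 3, EAtom]])
       (EVar 3)"

text \<open>Borrows through the low zero bits. The inner conditional drops a top bit that becomes 0,
  as codes have no leading zeros. On 0 the recursion would not end; \<open>take_body\<close> tests
  for 0 first.\<close>

definition pred_body :: expr where
  "pred_body =
     EIf (EHd (EVar 0))
       (EIf (ETl (EVar 0)) (EPair EAtom (ETl (EVar 0))) EAtom)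
       (EPair (EPair EAtom EAtom) (ECall 12 [ETl (EVar 0)]))"

definition take_body :: expr where
  "take_body =
     EIf (EVar 0)
       (EIf (EVar 1)
          (EPair (EHd (EVar 0)) (ECall 13 [ETl (EVar 0), ECall 12 [EVar 1]]))
          EAtom)
       EAtom"

definition unary_body :: expr where
  "unary_body =
     EIf (EVar 0)
       (ECall 15 [ECall 14 [ETl (EVar 0)], EIf (EHd (EVar 0)) (EPair EAtom EAtom) EAtom])
       EAtom"

definition double_body :: expr where
  "double_body =
     EIf (EVar 0) (EPair EAtom (EPair EAtom (ECall 15 [ETl (EVar 0), EVar 1]))) (EVar 1)"

text \<open>Argument 0 is the result of the previous round. The tree for \<open>k + 1\<close> is
  both the strict budget of the round for \<open>k\<close> and the counter of the next
  round.\<close>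

definition search_body :: expr where
  "search_body =
     EIf (EVar 0) (EVar 0)
       (ECall 16 [ECall 11 [EVar 1, EPair EAtom (EVar 2), EVar 3, EPair EAtom EAtom],
          EVar 1, EPair EAtom (EVar 2), EVar 3])"

text \<open>No entry of the shared part calls index 0, so the facts about it hold for every
  \<open>e\<close> and serve all three programs.\<close>

definition with_main :: "expr \<Rightarrow> prog" where
  "with_main e =
     [e, eq_body, bef_body, supported_body, pay_pair_body, pay_row_body, pay_body,
      rev_append_body, keep_body, inserts_body, extend_body, enumerate_body, pred_body,
      take_body, unary_body, double_body, search_body]"

lemma call_with_main:
  "call (with_main e) 0 env = eval (with_main e) env e"
  "call (with_main e) 1 env = eval (with_main e) env eq_body"
  "call (with_main e) 2 env = eval (with_main e) env bef_body"
  "call (with_main e) 3 env = eval (with_main e) env supported_body"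
  "call (with_main e) 4 env = eval (with_main e) env pay_pair_body"
  "call (with_main e) 5 env = eval (with_main e) env pay_row_body"
  "call (with_main e) 6 env = eval (with_main e) env pay_body"
  "call (with_main e) 7 env = eval (with_main e) env rev_append_body"
  "call (with_main e) 8 env = eval (with_main e) env keep_body"
  "call (with_main e) 9 env = eval (with_main e) env inserts_body"
  "call (with_main e) 10 env = eval (with_main e) env extend_body"
  "call (with_main e) 11 env = eval (with_main e) env enumerate_body"
  "call (with_main e) 12 env = eval (with_main e) env pred_body"
  "call (with_main e) 13 env = eval (with_main e) env take_body"
  "call (with_main e) 14 env = eval (with_main e) env unary_body"
  "call (with_main e) 15 env = eval (with_main e) env double_body"
  "call (with_main e) 16 env = eval (with_main e) env search_body"
  by (simp_all add: call_def with_main_def)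

section \<open>Enumeration of rankings\<close>

fun bef :: "nat list \<Rightarrow> nat \<Rightarrow> nat \<Rightarrow> bool" where
  "bef [] x y \<longleftrightarrow> False"
| "bef (a # v) x y \<longleftrightarrow> a = x \<or> a \<noteq> y \<and> bef v x y"

text \<open>The positive form of unanimity: all votes order an unsupported pair the other way, so
  respecting unanimity becomes a condition on each pair of the ranking separately.\<close>

definition supported :: "nat list list \<Rightarrow> nat \<Rightarrow> nat \<Rightarrow> bool" where
  "supported vs x y \<longleftrightarrow> (\<exists>v\<in>set vs. bef v x y)"

definition opposed :: "nat list list \<Rightarrow> nat \<Rightarrow> nat \<Rightarrow> nat" where
  "opposed vs x y = length (filter (\<lambda>v. bef v y x) vs)"

fun score :: "nat list list \<Rightarrow> nat list \<Rightarrow> nat" where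
  "score vs [] = 0"
| "score vs (x # q) = sum_list (map (opposed vs x) q) + score vs q"

text \<open>The strict bound matches the program: under truncated subtraction,
  \<open>score vs q < b\<close> says that the rest \<open>b - score vs q\<close> of the budget is
  positive.\<close>

definition good :: "nat list list \<Rightarrow> nat \<Rightarrow> nat list \<Rightarrow> bool" where
  "good vs b q \<longleftrightarrow> sorted_wrt (supported vs) q \<and> score vs q < b"

fun inserts :: "'a \<Rightarrow> 'a list \<Rightarrow> 'a list list" where
  "inserts c [] = [[c]]"
| "inserts c (a # l) = (c # a # l) # map ((#) a) (inserts c l)"

text \<open>\<open>rev\<close> reproduces the order in which the program conses accepted rankings
  onto its accumulator.\<close>

definition extend :: "(nat list \<Rightarrow> bool) \<Rightarrow> nat \<Rightarrow> nat list list \<Rightarrow> nat list list" where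
  "extend g c L = rev (filter g (concat (map (inserts c) L)))"

definition enumeration :: "nat list list \<Rightarrow> nat \<Rightarrow> nat list \<Rightarrow> nat list list" where
  "enumeration vs k cs = fold (extend (good vs (Suc k))) cs [[]]"

lemma sum_list_inserts:
  fixes f :: "'a \<Rightarrow> nat"
  shows "q \<in> set (inserts c l) \<Longrightarrow> sum_list (map f q) = f c + sum_list (map f l)"
  by (induction l arbitrary: q) auto

lemma set_inserts_elem: "q \<in> set (inserts c l) \<Longrightarrow> set q = insert c (set l)"
  by (induction l arbitrary: q) auto

lemma length_inserts_elem: "q \<in> set (inserts c l) \<Longrightarrow> length q = Suc (length l)"
  by (induction l arbitrary: q) auto

lemma score_inserts_ge: "q \<in> set (inserts c l) \<Longrightarrow> score vs l \<le> score vs q"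
  by (induction l arbitrary: q) (auto simp: sum_list_inserts, meson trans_le_add2)

section \<open>Weight and number of the stored rankings\<close>

definition weight :: "nat list list \<Rightarrow> nat list list \<Rightarrow> real" where
  "weight vs L = (\<Sum>q\<leftarrow>L. (1/2) ^ score vs q)"

lemma weight_simps [simp]:
  "weight vs [] = 0" "weight vs (q # L) = (1/2) ^ score vs q + weight vs L"
  "weight vs (L @ L') = weight vs L + weight vs L'" "weight vs (rev L) = weight vs L"
  by (simp_all add: weight_def rev_map[symmetric])

lemma weight_filter_Cons:
  "weight vs (filter g (q # L)) = (if g q then (1/2) ^ score vs q else 0) + weight vs (filter g L)"
  by simp

lemma opposed_pos: "supported vs x y \<Longrightarrow> opposed vs y x \<ge> 1"
  by (induction vs) (auto simp: supported_def opposed_def)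

text \<open>A Kraft inequality: if both orders of \<open>a\<close> and \<open>c\<close> are supported, each of them costs at least 1
  and so halves the weight; otherwise only one of them occurs.\<close>
lemma weight_inserts:
  "weight vs (filter (sorted_wrt (supported vs)) (inserts c l)) \<le> (1/2) ^ score vs l"
proof (induction l)
  case Nil
  show ?case by (simp add: weight_def)
next
  case (Cons a l)
  let ?ok = "sorted_wrt (supported vs)"
  let ?R = "sum_list (map (opposed vs a) l)"
  define F where "F = weight vs (filter ?ok (inserts c l))"
  have F: "F \<le> (1/2) ^ score vs l" using Cons.IH by (simp add: F_def)
  have split: "weight vs (filter ?ok (inserts c (a # l))) =
    (if ?ok (c # a # l) then (1/2) ^ score vs (c # a # l) else 0) +
    weight vs (filter ?ok (map ((#) a) (inserts c l)))"
    by (simp add: weight_def)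
  \<comment> \<open>Putting \<open>a\<close> in front multiplies all weights by one factor, as the
    cost of \<open>a\<close> does not depend on where \<open>c\<close> stands. Without support for
    \<open>a\<close> before \<open>c\<close> nothing survives.\<close>
  have tail: "weight vs (filter ?ok (map ((#) a) (inserts c l))) \<le>
      (if supported vs a c then (1/2) ^ opposed vs a c else 0) * (1/2) ^ ?R * F"
  proof -
    let ?k = "(if supported vs a c then (1/2) ^ opposed vs a c else 0) * (1/2) ^ ?R :: real"
    have "weight vs (filter ?ok (map ((#) a) Q)) \<le> ?k * weight vs (filter ?ok Q)"
      if "set Q \<subseteq> set (inserts c l)" for Q
      using that
    proof (induction Q)
      case Nil
      show ?case by (simp add: weight_def)
    next
      case (Cons q Q)
      have q: "sum_list (map (opposed vs a) q) = opposed vs a c + ?R" "c \<in> set q"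
        using Cons.prems sum_list_inserts[of q c l "opposed vs a"] set_inserts_elem[of q c l] by auto
      have "(if ?ok (a # q) then (1/2) ^ score vs (a # q) else 0) \<le>
          ?k * (if ?ok q then (1/2) ^ score vs q else 0)"
        using q by (auto simp: power_add)
      with Cons show ?case
        unfolding list.map weight_filter_Cons distrib_left by (intro add_mono) auto
    qed
    then show ?thesis by (simp add: F_def)
  qed
  \<comment> \<open>The cost of \<open>c\<close> against the candidates of \<open>l\<close> is
    dropped; its cost against \<open>a\<close> is kept.\<close>
  have head: "(if ?ok (c # a # l) then (1/2) ^ score vs (c # a # l) else 0) \<le>
      (if supported vs c a then (1/2) ^ opposed vs c a else 0) * (1/2) ^ ?R * (1/2 :: real) ^ score vs l"
    by (auto simp: power_add intro!: mult_left_le mult_right_le_one_le power_le_one)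
  have R: "(1/2 :: real) ^ ?R * (1/2) ^ score vs l = (1/2) ^ score vs (a # l)"
    by (simp add: power_add)
  have half: "(1/2 :: real) ^ m \<le> 1/2" if "m \<ge> 1" for m
    using power_decreasing[of 1 m "1/2 :: real"] that by simp
  have *: "(if supported vs a c then (1/2) ^ opposed vs a c else 0) +
      (if supported vs c a then (1/2) ^ opposed vs c a else 0) \<le> (1 :: real)"
    using half[of "opposed vs a c"] half[of "opposed vs c a"]
      opposed_pos[of vs a c] opposed_pos[of vs c a] by (auto simp: power_le_one)
  let ?A = "(if supported vs a c then (1/2) ^ opposed vs a c else 0) :: real"
  let ?B = "(if supported vs c a then (1/2) ^ opposed vs c a else 0) :: real"
  have "weight vs (filter ?ok (inserts c (a # l))) \<le>
      ?B * (1/2) ^ ?R * (1/2) ^ score vs l + ?A * (1/2) ^ ?R * (1/2) ^ score vs l"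
    unfolding split using head tail F
    by (intro add_mono order_trans[OF tail] mult_left_mono) auto
  also have "\<dots> = (?A + ?B) * (1/2) ^ score vs (a # l)"
    unfolding R[symmetric] by (simp only: distrib_right mult.assoc add.commute)
  also have "\<dots> \<le> 1 * (1/2) ^ score vs (a # l)"
    using * by (intro mult_right_mono) auto
  finally show ?case by simp
qed

lemma weight_filter_mono:
  "(\<And>q. q \<in> set L \<Longrightarrow> g q \<Longrightarrow> h q) \<Longrightarrow> weight vs (filter g L) \<le> weight vs (filter h L)"
proof (induction L)
  case (Cons q L)
  then have "weight vs (filter g L) \<le> weight vs (filter h L)" by simp
  moreover have "(if g q then (1/2 :: real) ^ score vs q else 0) \<le>
      (if h q then (1/2) ^ score vs q else 0)"
    using Cons.prems by auto
  ultimately show ?case unfolding weight_filter_Cons by (intro add_mono)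
qed simp

lemma weight_extend: "weight vs (extend (good vs b) c L) \<le> weight vs L"
proof -
  have "weight vs (filter (good vs b) (concat (map (inserts c) L))) \<le> weight vs L"
  proof (induction L)
    case (Cons l L)
    have "weight vs (filter (good vs b) (inserts c l)) \<le> (1/2) ^ score vs l"
      by (rule order_trans[OF weight_filter_mono weight_inserts]) (simp add: good_def)
    with Cons show ?case by simp
  qed simp
  then show ?thesis by (simp add: extend_def)
qed

text \<open>A ranking of score at most \<open>k\<close> contributes at least
  \<open>(1/2) ^ k\<close> to the weight.\<close>

lemma length_le_weight:
  assumes "\<forall>q\<in>set L. good vs (Suc k) q"
  shows "real (length L) \<le> 2 ^ k * weight vs L"
  using assms
proof (induction L)
  case (Cons q L)
  have "(1/2 :: real) ^ k \<le> (1/2) ^ score vs q"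
    using Cons.prems by (intro power_decreasing) (auto simp: good_def)
  then have "1 \<le> 2 ^ k * (1/2 :: real) ^ score vs q"
    by (simp add: field_simps)
  with Cons show ?case by (simp add: distrib_left)
qed simp

text \<open>The invariant of the enumeration. A bound on the length alone would not be inductive;
  the weight never grows, and goodness turns its bound into one on the length.\<close>

definition bounded_family :: "nat list list \<Rightarrow> nat \<Rightarrow> nat list list \<Rightarrow> bool" where
  "bounded_family vs k L \<longleftrightarrow> weight vs L \<le> 1 \<and> (\<forall>q\<in>set L. good vs (Suc k) q)"

lemma length_bounded_family:
  assumes "bounded_family vs k L"
  shows "length L \<le> 2 ^ k"
proof -
  have "real (length L) \<le> 2 ^ k * weight vs L"
    using assms by (intro length_le_weight) (simp add: bounded_family_def)
  also have "\<dots> \<le> 2 ^ k * 1"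
    using assms by (intro mult_left_mono) (auto simp: bounded_family_def)
  finally show ?thesis
    by (metis mult.right_neutral of_nat_le_iff of_nat_numeral of_nat_power)
qed

lemma bounded_family_Nil: "bounded_family vs k [[]]"
  by (simp add: bounded_family_def good_def)

lemma bounded_family_extend:
  "bounded_family vs k L \<Longrightarrow> bounded_family vs k (extend (good vs (Suc k)) c L)"
  using weight_extend[of vs "Suc k" c L] by (auto simp: bounded_family_def extend_def)

lemma bounded_family_fold_extend:
  "bounded_family vs k L \<Longrightarrow> bounded_family vs k (fold (extend (good vs (Suc k))) cs L)"
  by (induction cs arbitrary: L) (auto intro: bounded_family_extend)

lemma length_enumeration: "length (enumeration vs k cs) \<le> 2 ^ k"
  unfolding enumeration_def
  by (intro length_bounded_family[of vs] bounded_family_fold_extend bounded_family_Nil)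

section \<open>Correctness and completeness of the enumeration\<close>

lemma set_inserts: "set (inserts c l) = {l1 @ c # l2 | l1 l2. l = l1 @ l2}"
proof (induction l)
  case (Cons a l)
  show ?case
    by (auto simp: Cons Cons_eq_append_conv) blast+
qed simp

lemma distinct_inserts: "c \<notin> set l \<Longrightarrow> distinct (inserts c l)"
  by (induction l) (auto simp: distinct_map)

text \<open>The ranking that an insertion comes from can be recovered, so insertions into different
  rankings never coincide.\<close>

lemma removeAll_inserts: "q \<in> set (inserts c l) \<Longrightarrow> c \<notin> set l \<Longrightarrow> removeAll c q = l"
  by (induction l arbitrary: q) auto

text \<open>Goodness survives the removal of a candidate; hence early pruning loses no final
  ranking.\<close>

lemma good_inserts: "q \<in> set (inserts c l) \<Longrightarrow> good vs b q \<Longrightarrow> good vs b l"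
  using score_inserts_ge[of q c l vs] by (auto simp: good_def set_inserts sorted_wrt_append)

lemma distinct_concat_inserts:
  "distinct L \<Longrightarrow> \<forall>l\<in>set L. c \<notin> set l \<Longrightarrow> distinct (concat (map (inserts c) L))"
  by (induction L) (auto simp: distinct_inserts dest: removeAll_inserts)

lemma enumeration_spec:
  "distinct cs \<Longrightarrow> distinct (enumeration vs k cs) \<and>
    set (enumeration vs k cs) = {q. distinct q \<and> set q = set cs \<and> good vs (Suc k) q}"
proof (induction cs rule: rev_induct)
  case Nil
  show ?case by (auto simp: enumeration_def good_def)
next
  case (snoc c cs)
  let ?L = "enumeration vs k cs"
  have L: "distinct ?L" "set ?L = {q. distinct q \<and> set q = set cs \<and> good vs (Suc k) q}"
    "c \<notin> set cs"
    using snoc by auto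
  have step: "enumeration vs k (cs @ [c]) = extend (good vs (Suc k)) c ?L"
    by (simp add: enumeration_def)
  have "q \<in> set (extend (good vs (Suc k)) c ?L) \<longleftrightarrow>
      distinct q \<and> set q = set (cs @ [c]) \<and> good vs (Suc k) q" for q
  proof
    assume "q \<in> set (extend (good vs (Suc k)) c ?L)"
    then obtain l where "l \<in> set ?L" "q \<in> set (inserts c l)" "good vs (Suc k) q"
      by (auto simp: extend_def)
    with L show "distinct q \<and> set q = set (cs @ [c]) \<and> good vs (Suc k) q"
      by (auto simp: set_inserts)
  next
    assume q: "distinct q \<and> set q = set (cs @ [c]) \<and> good vs (Suc k) q"
    then obtain l1 l2 where l: "q = l1 @ c # l2"
      using split_list[of c q] by auto
    then have ins: "q \<in> set (inserts c (l1 @ l2))" by (auto simp: set_inserts)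
    have "set (l1 @ l2) = set cs" using q l L(3) by auto
    then have "l1 @ l2 \<in> set ?L" using q l L(2) good_inserts[OF ins] by auto
    then show "q \<in> set (extend (good vs (Suc k)) c ?L)"
      using q ins by (auto simp: extend_def)
  qed
  moreover have "distinct (extend (good vs (Suc k)) c ?L)"
    using L by (auto simp: extend_def intro!: distinct_filter distinct_concat_inserts)
  ultimately show ?case unfolding step by auto
qed

section \<open>Running times\<close>

definition enc_bool :: "bool \<Rightarrow> tree" where
  "enc_bool b = (if b then Pair Atom Atom else Atom)"

definition enc_unary :: "nat \<Rightarrow> tree" where
  "enc_unary n = (Pair Atom ^^ n) Atom"

lemma enc_unary_simps [simp]:
  "enc_unary 0 = Atom" "enc_unary (Suc n) = Pair Atom (enc_unary n)"
  by (simp_all add: enc_unary_def)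

lemma enc_unary_eq_Atom [simp]: "enc_unary n = Atom \<longleftrightarrow> n = 0"
  by (cases n) simp_all

lemma ttl_enc_unary [simp]: "ttl (enc_unary n) = enc_unary (n - 1)"
  by (cases n) simp_all

lemma enc_list_eq_Atom [simp]: "enc_list f xs = Atom \<longleftrightarrow> xs = []"
  by (cases xs) simp_all

lemma enc_nat_0 [simp]: "enc_nat 0 = Atom"
  by (simp add: enc_nat.simps)

lemma enc_nat_pos: "n > 0 \<Longrightarrow> enc_nat n = Pair (enc_bool (odd n)) (enc_nat (n div 2))"
  by (subst enc_nat.simps) (simp add: enc_bool_def)

lemma enc_nat_eq_Atom [simp]: "enc_nat n = Atom \<longleftrightarrow> n = 0"
  by (cases "n = 0") (simp_all add: enc_nat_pos)

text \<open>Justifies comparing candidates as trees.\<close>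

lemma enc_nat_inject [simp]: "enc_nat m = enc_nat n \<longleftrightarrow> m = n"
proof (induction m arbitrary: n rule: less_induct)
  case (less m)
  show ?case
  proof (cases "m = 0 \<or> n = 0")
    case True
    then show ?thesis by (metis enc_nat_0 enc_nat_eq_Atom)
  next
    case False
    then have "enc_nat m = enc_nat n \<longleftrightarrow> (odd m \<longleftrightarrow> odd n) \<and> m div 2 = n div 2"
      using less[of "m div 2" "n div 2"] by (auto simp: enc_nat_pos enc_bool_def)
    also have "\<dots> \<longleftrightarrow> m = n"
      by presburger
    finally show ?thesis .
  qed
qed

abbreviation enc_ranking :: "nat list \<Rightarrow> tree" where
  "enc_ranking \<equiv> enc_list enc_nat"

abbreviation enc_rankings :: "nat list list \<Rightarrow> tree" where
  "enc_rankings \<equiv> enc_list enc_ranking"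

section \<open>Cost of checking one ranking\<close>

definition small :: "nat \<Rightarrow> nat \<Rightarrow> bool" where
  "small N x \<longleftrightarrow> size (enc_nat x) \<le> N"

definition fits :: "nat \<Rightarrow> nat list list \<Rightarrow> bool" where
  "fits N vs \<longleftrightarrow> length vs \<le> N \<and> (\<forall>v\<in>set vs. length v \<le> N)"

text \<open>These bounds follow the nesting of the loops, each being a number of iterations times
  the cost of one; \<open>N\<close> will be the input size. Here \<open>200 * N\<close> pays for two
  comparisons of trees. The additive constants generously cover the fixed number of steps outside of
  calls.\<close>

definition bef_time :: "nat \<Rightarrow> nat" where
  "bef_time N = N * (200 * N + 150) + 50"

definition votes_time :: "nat \<Rightarrow> nat" where
  "votes_time N = N * (bef_time N + 50) + 50"

definition row_time :: "nat \<Rightarrow> nat" where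
  "row_time N = N * (2 * votes_time N + 50) + 50"

definition pay_time :: "nat \<Rightarrow> nat" where
  "pay_time N = N * (row_time N + 50) + 50"

definition inserts_time :: "nat \<Rightarrow> nat" where
  "inserts_time N = (N + 1) * (50 * N + pay_time N + 250)"

definition enumerate_time :: "nat \<Rightarrow> nat" where
  "enumerate_time N = N * (inserts_time N + 200) + 50"

text \<open>The recursion descends both trees at once, so the size of the first alone bounds it;
  this is why \<open>call_bef\<close> restricts the sizes of \<open>x\<close> and \<open>y\<close>
  only. Each inner node leaves 50 steps for its own work.\<close>

lemma call_eq:
  "\<exists>t\<le>100 * size a + 50. call (with_main e) 1 [a, b] = Some (enc_bool (a = b), t)"
proof (induction a arbitrary: b)
  case Atom
  show ?case by (subst call_with_main) (simp add: eq_body_def enc_bool_def)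
next
  case (Pair a1 a2)
  show ?case
  proof (cases b)
    case Atom
    then show ?thesis by (subst call_with_main) (simp add: eq_body_def enc_bool_def)
  next
    case b: (Pair b1 b2)
    obtain t1 t2 where "t1 \<le> 100 * size a1 + 50" "t2 \<le> 100 * size a2 + 50"
      "call (with_main e) 1 [a1, b1] = Some (enc_bool (a1 = b1), t1)"
      "call (with_main e) 1 [a2, b2] = Some (enc_bool (a2 = b2), t2)"
      using Pair.IH by meson
    with b show ?thesis by (subst call_with_main) (auto simp: eq_body_def enc_bool_def)
  qed
qed

lemma call_bef:
  assumes "small N x" "small N y" "length v \<le> N"
  shows "\<exists>t\<le>bef_time N.
    call (with_main e) 2 [enc_ranking v, enc_nat x, enc_nat y] = Some (enc_bool (bef v x y), t)"
proof -
  \<comment> \<open>The induction needs a bound that shrinks with the list; it is relaxed to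
    \<open>N\<close> at the end. The next four lemmas proceed in the same way.\<close>
  have "\<exists>t\<le>length v * (200 * N + 150) + 50.
    call (with_main e) 2 [enc_ranking v, enc_nat x, enc_nat y] = Some (enc_bool (bef v x y), t)"
  proof (induction v)
    case Nil
    show ?case by (subst call_with_main) (simp add: bef_body_def enc_bool_def)
  next
    case (Cons a v)
    obtain t1 t2 t3 where
      "t1 \<le> 100 * size (enc_nat x) + 50" "t2 \<le> 100 * size (enc_nat y) + 50"
      "t3 \<le> length v * (200 * N + 150) + 50"
      "call (with_main e) 1 [enc_nat x, enc_nat a] = Some (enc_bool (x = a), t1)"
      "call (with_main e) 1 [enc_nat y, enc_nat a] = Some (enc_bool (y = a), t2)"
      "call (with_main e) 2 [enc_ranking v, enc_nat x, enc_nat y] = Some (enc_bool (bef v x y), t3)"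
      using call_eq[of "enc_nat x" e "enc_nat a"] call_eq[of "enc_nat y" e "enc_nat a"] Cons.IH
      by auto
    with assms show ?case
      by (subst call_with_main) (auto simp: small_def bef_body_def enc_bool_def algebra_simps)
  qed
  moreover have "length v * (200 * N + 150) + 50 \<le> bef_time N"
    using assms(3) by (simp add: bef_time_def)
  ultimately show ?thesis using le_trans by blast
qed

lemma call_supported:
  assumes "fits N vs" "small N x" "small N y"
  shows "\<exists>t\<le>votes_time N. call (with_main e) 3 [enc_rankings vs, enc_nat x, enc_nat y] =
    Some (enc_bool (supported vs x y), t)"
proof -
  have "\<exists>t\<le>length vs * (bef_time N + 50) + 50.
    call (with_main e) 3 [enc_rankings vs, enc_nat x, enc_nat y] =
    Some (enc_bool (supported vs x y), t)"
    if "\<forall>v\<in>set vs. length v \<le> N"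
    using that
  proof (induction vs)
    case Nil
    show ?case by (subst call_with_main) (simp add: supported_body_def supported_def enc_bool_def)
  next
    case (Cons v vs)
    obtain t1 t2 where
      "t1 \<le> bef_time N" "t2 \<le> length vs * (bef_time N + 50) + 50"
      "call (with_main e) 2 [enc_ranking v, enc_nat x, enc_nat y] = Some (enc_bool (bef v x y), t1)"
      "call (with_main e) 3 [enc_rankings vs, enc_nat x, enc_nat y] =
        Some (enc_bool (supported vs x y), t2)"
      using call_bef[OF assms(2,3), of v e] Cons by auto
    then show ?case
      by (subst call_with_main)
        (auto simp: supported_body_def supported_def enc_bool_def algebra_simps)
  qed
  moreover have "length vs * (bef_time N + 50) + 50 \<le> votes_time N"
    using assms(1) by (simp add: votes_time_def fits_def)
  ultimately show ?thesis using le_trans assms(1) unfolding fits_def by blast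
qed

lemma call_pay_pair:
  assumes "fits N vs" "small N x" "small N y"
  shows "\<exists>t\<le>votes_time N.
    call (with_main e) 4 [enc_rankings vs, enc_nat x, enc_nat y, enc_unary b] =
    Some (enc_unary (b - opposed vs x y), t)"
proof -
  have "\<exists>t\<le>length vs * (bef_time N + 50) + 50.
    call (with_main e) 4 [enc_rankings vs, enc_nat x, enc_nat y, enc_unary b] =
    Some (enc_unary (b - opposed vs x y), t)"
    if "\<forall>v\<in>set vs. length v \<le> N"
    using that
  proof (induction vs arbitrary: b)
    case Nil
    show ?case by (subst call_with_main) (simp add: pay_pair_body_def opposed_def)
  next
    case (Cons v vs)
    \<comment> \<open>Truncated subtraction composes: taking 1 and then \<open>m\<close> units is
      taking \<open>1 + m\<close>, even when the budget runs out.\<close>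
    let ?b = "if bef v y x then b - 1 else b"
    obtain t1 t2 where
      "t1 \<le> bef_time N" "t2 \<le> length vs * (bef_time N + 50) + 50"
      "call (with_main e) 2 [enc_ranking v, enc_nat y, enc_nat x] = Some (enc_bool (bef v y x), t1)"
      "call (with_main e) 4 [enc_rankings vs, enc_nat x, enc_nat y, enc_unary ?b] =
        Some (enc_unary (?b - opposed vs x y), t2)"
      using call_bef[OF assms(3,2), of v e] Cons.IH[of ?b] Cons.prems by auto
    then show ?case
      by (subst call_with_main)
        (auto simp: pay_pair_body_def opposed_def enc_bool_def algebra_simps split: if_splits)
  qed
  moreover have "length vs * (bef_time N + 50) + 50 \<le> votes_time N"
    using assms(1) by (simp add: votes_time_def fits_def)
  ultimately show ?thesis using le_trans assms(1) unfolding fits_def by blast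
qed

lemma call_pay_row:
  assumes "fits N vs" "small N x" "\<forall>y\<in>set ys. small N y" "length ys \<le> N"
  shows "\<exists>t\<le>row_time N.
    call (with_main e) 5 [enc_rankings vs, enc_nat x, enc_ranking ys, enc_unary b] =
    Some (enc_unary (if \<forall>y\<in>set ys. supported vs x y
      then b - sum_list (map (opposed vs x) ys) else 0), t)"
proof -
  have "\<exists>t\<le>length ys * (2 * votes_time N + 50) + 50.
    call (with_main e) 5 [enc_rankings vs, enc_nat x, enc_ranking ys, enc_unary b] =
    Some (enc_unary (if \<forall>y\<in>set ys. supported vs x y
      then b - sum_list (map (opposed vs x) ys) else 0), t)"
    using assms(3)
  proof (induction ys arbitrary: b)
    case Nil
    show ?case by (subst call_with_main) (simp add: pay_row_body_def)
  next
    case (Cons y ys)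
    let ?b = "b - opposed vs x y"
    obtain t1 t2 t3 where
      "t1 \<le> votes_time N" "t2 \<le> votes_time N" "t3 \<le> length ys * (2 * votes_time N + 50) + 50"
      "call (with_main e) 3 [enc_rankings vs, enc_nat x, enc_nat y] =
        Some (enc_bool (supported vs x y), t1)"
      "call (with_main e) 4 [enc_rankings vs, enc_nat x, enc_nat y, enc_unary b] =
        Some (enc_unary ?b, t2)"
      "call (with_main e) 5 [enc_rankings vs, enc_nat x, enc_ranking ys, enc_unary ?b] =
        Some (enc_unary (if \<forall>y\<in>set ys. supported vs x y
          then ?b - sum_list (map (opposed vs x) ys) else 0), t3)"
      using call_supported[OF assms(1,2), of y e] call_pay_pair[OF assms(1,2), of y e b]
        Cons.IH[of ?b] Cons.prems by auto
    then show ?case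
      by (subst call_with_main)
        (auto simp: pay_row_body_def enc_bool_def algebra_simps split: if_splits)
  qed
  moreover have "length ys * (2 * votes_time N + 50) + 50 \<le> row_time N"
    using assms(4) by (simp add: row_time_def)
  ultimately show ?thesis using le_trans by blast
qed

text \<open>An unsupported pair sets the budget to 0, from which later rows cannot recover; thus one
  number carries both conditions of \<open>good\<close>.\<close>

lemma call_pay:
  assumes "fits N vs" "\<forall>y\<in>set q. small N y" "length q \<le> N"
  shows "\<exists>t\<le>pay_time N.
    call (with_main e) 6 [enc_rankings vs, enc_ranking q, enc_unary b] =
    Some (enc_unary (if sorted_wrt (supported vs) q then b - score vs q else 0), t)"
proof -
  have "\<exists>t\<le>length q * (row_time N + 50) + 50.
    call (with_main e) 6 [enc_rankings vs, enc_ranking q, enc_unary b] =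
    Some (enc_unary (if sorted_wrt (supported vs) q then b - score vs q else 0), t)"
    using assms(2,3)
  proof (induction q arbitrary: b)
    case Nil
    show ?case by (subst call_with_main) (simp add: pay_body_def)
  next
    case (Cons x q)
    let ?b = "if \<forall>y\<in>set q. supported vs x y then b - sum_list (map (opposed vs x) q) else 0"
    obtain t1 t2 where
      "t1 \<le> row_time N" "t2 \<le> length q * (row_time N + 50) + 50"
      "call (with_main e) 5 [enc_rankings vs, enc_nat x, enc_ranking q, enc_unary b] =
        Some (enc_unary ?b, t1)"
      "call (with_main e) 6 [enc_rankings vs, enc_ranking q, enc_unary ?b] =
        Some (enc_unary (if sorted_wrt (supported vs) q then ?b - score vs q else 0), t2)"
      using call_pay_row[OF assms(1), of x q e b] Cons.IH[of ?b] Cons.prems by auto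
    then show ?case
      by (subst call_with_main) (auto simp: pay_body_def algebra_simps split: if_splits)
  qed
  moreover have "length q * (row_time N + 50) + 50 \<le> pay_time N"
    using assms(3) by (simp add: pay_time_def)
  ultimately show ?thesis using le_trans by blast
qed

section \<open>Cost of insertion and enumeration\<close>

text \<open>The tree \<open>s\<close> and the encoding \<open>f\<close> are arbitrary because
  \<open>computable_power2\<close> uses the same function to prepend bits to a number.\<close>

lemma call_rev_append:
  "\<exists>t\<le>50 * length xs + 50.
    call (with_main e) 7 [enc_list f xs, s] = Some (fold (\<lambda>x. Pair (f x)) xs s, t)"
proof (induction xs arbitrary: s)
  case Nil
  show ?case by (subst call_with_main) (simp add: rev_append_body_def)
next
  case (Cons x xs)
  obtain t where "t \<le> 50 * length xs + 50"
    "call (with_main e) 7 [enc_list f xs, Pair (f x) s] =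
      Some (fold (\<lambda>x. Pair (f x)) xs (Pair (f x) s), t)"
    using Cons.IH by blast
  then show ?case by (subst call_with_main) (auto simp: rev_append_body_def)
qed

lemma fold_Pair_enc_list: "fold (\<lambda>x. Pair (f x)) xs (enc_list f ys) = enc_list f (rev xs @ ys)"
  by (induction xs arbitrary: ys) (simp_all flip: enc_list.simps)

lemma call_keep:
  assumes "fits N vs" "\<forall>y\<in>set q. small N y" "length q \<le> N"
  shows "\<exists>t\<le>pay_time N + 50.
    call (with_main e) 8 [enc_rankings vs, enc_unary b, enc_ranking q, enc_rankings out] =
    Some (enc_rankings (if good vs b q then q # out else out), t)"
proof -
  obtain t where "t \<le> pay_time N"
    "call (with_main e) 6 [enc_rankings vs, enc_ranking q, enc_unary b] =
      Some (enc_unary (if sorted_wrt (supported vs) q then b - score vs q else 0), t)"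
    using call_pay[OF assms] by blast
  then show ?thesis
    by (subst call_with_main) (auto simp: keep_body_def good_def)
qed

text \<open>Generalised over the prefix \<open>pre\<close> that the zipper has passed. The strict
  inequality leaves room for \<open>c\<close>, so that the rankings checked have length at most
  \<open>N\<close>.\<close>

lemma call_inserts:
  assumes "fits N vs" "small N c"
  shows "\<forall>y\<in>set l. small N y \<Longrightarrow> \<forall>y\<in>set pre. small N y \<Longrightarrow> length pre + length l < N \<Longrightarrow>
    \<exists>t\<le>(length l + 1) * (50 * N + pay_time N + 250).
    call (with_main e) 9 [enc_rankings vs, enc_unary b, enc_nat c, enc_ranking pre,
      enc_ranking l, enc_rankings out] =
    Some (enc_rankings (rev (filter (good vs b) (map ((@) (rev pre)) (inserts c l))) @ out), t)"
proof (induction l arbitrary: pre out)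
  case Nil
  let ?q = "rev pre @ [c]"
  obtain t1 t2 where "t1 \<le> 50 * length pre + 50" "t2 \<le> pay_time N + 50"
    "call (with_main e) 7 [enc_ranking pre, Pair (enc_nat c) Atom] = Some (enc_ranking ?q, t1)"
    "call (with_main e) 8 [enc_rankings vs, enc_unary b, enc_ranking ?q, enc_rankings out] =
      Some (enc_rankings (if good vs b ?q then ?q # out else out), t2)"
    using call_rev_append[of pre e enc_nat "enc_ranking [c]"] call_keep[of N vs ?q e b out] Nil assms
    by (auto simp del: enc_list.simps(2) simp: fold_Pair_enc_list) auto
  with Nil.prems show ?case
    by (subst call_with_main) (auto simp: inserts_body_def Let_def)
next
  case (Cons a l)
  let ?q = "rev pre @ c # a # l"
  let ?out = "if good vs b ?q then ?q # out else out"
  obtain t1 where t1: "t1 \<le> 50 * length pre + 50"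
    "call (with_main e) 7 [enc_ranking pre, enc_ranking (c # a # l)] = Some (enc_ranking ?q, t1)"
    using call_rev_append[of pre e enc_nat "enc_ranking (c # a # l)"]
    unfolding fold_Pair_enc_list by blast
  have "\<exists>t\<le>pay_time N + 50.
      call (with_main e) 8 [enc_rankings vs, enc_unary b, enc_ranking ?q, enc_rankings out] =
      Some (enc_rankings ?out, t)"
    using Cons.prems assms by (intro call_keep) auto
  then obtain t2 where t2: "t2 \<le> pay_time N + 50"
    "call (with_main e) 8 [enc_rankings vs, enc_unary b, enc_ranking ?q, enc_rankings out] =
      Some (enc_rankings ?out, t2)"
    by blast
  have "\<exists>t\<le>(length l + 1) * (50 * N + pay_time N + 250).
    call (with_main e) 9 [enc_rankings vs, enc_unary b, enc_nat c, enc_ranking (a # pre),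
      enc_ranking l, enc_rankings ?out] =
      Some (enc_rankings (rev (filter (good vs b) (map ((@) (rev (a # pre))) (inserts c l))) @ ?out),
        t)"
    using Cons.prems by (intro Cons.IH) auto
  then obtain t3 where t3: "t3 \<le> (length l + 1) * (50 * N + pay_time N + 250)"
    "call (with_main e) 9 [enc_rankings vs, enc_unary b, enc_nat c, enc_ranking (a # pre),
      enc_ranking l, enc_rankings ?out] =
      Some (enc_rankings (rev (filter (good vs b) (map ((@) (rev (a # pre))) (inserts c l))) @ ?out),
        t3)"
    by blast
  have "(@) (rev (a # pre)) = (\<lambda>q. rev pre @ a # q)"
    by auto
  with t1 t2 t3 Cons.prems show ?case
    by (subst call_with_main) (auto simp: inserts_body_def Let_def algebra_simps comp_def)
qed

lemma append_Nil_id: "(@) [] = id"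
  by auto

lemma call_extend:
  assumes "fits N vs" "small N c"
  shows "\<forall>l\<in>set L. length l < N \<and> (\<forall>y\<in>set l. small N y) \<Longrightarrow>
    \<exists>t\<le>length L * (inserts_time N + 50) + 50.
    call (with_main e) 10 [enc_rankings vs, enc_unary b, enc_nat c, enc_rankings L,
      enc_rankings out] =
    Some (enc_rankings (extend (good vs b) c L @ out), t)"
proof (induction L arbitrary: out)
  case Nil
  show ?case by (subst call_with_main) (simp add: extend_body_def extend_def)
next
  case (Cons l L)
  let ?out = "rev (filter (good vs b) (inserts c l)) @ out"
  obtain t1 where t1: "t1 \<le> (length l + 1) * (50 * N + pay_time N + 250)"
    "call (with_main e) 9 [enc_rankings vs, enc_unary b, enc_nat c, Atom,
      enc_ranking l, enc_rankings out] = Some (enc_rankings ?out, t1)"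
    using call_inserts[OF assms, of l "[]" e b out] Cons.prems by (auto simp: append_Nil_id)
  obtain t2 where t2: "t2 \<le> length L * (inserts_time N + 50) + 50"
    "call (with_main e) 10 [enc_rankings vs, enc_unary b, enc_nat c, enc_rankings L,
      enc_rankings ?out] = Some (enc_rankings (extend (good vs b) c L @ ?out), t2)"
    using Cons.IH[of ?out] Cons.prems by auto
  have "(length l + 1) * (50 * N + pay_time N + 250) \<le> inserts_time N"
    unfolding inserts_time_def using Cons.prems by (intro mult_right_mono) auto
  with t1 t2 show ?case
    by (subst call_with_main) (auto simp: extend_body_def extend_def algebra_simps)
qed

text \<open>The factor \<open>2 ^ k\<close> enters through the length of every intermediate list, so
  the invariant is carried through the induction.\<close>

lemma call_enumerate:
  assumes "fits N vs"
  shows "bounded_family vs k L \<Longrightarrow> \<forall>c\<in>set cs. small N c \<Longrightarrow>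
    \<forall>l\<in>set L. length l + length cs \<le> N \<and> (\<forall>y\<in>set l. small N y) \<Longrightarrow>
    \<exists>t\<le>length cs * (2 ^ k * (inserts_time N + 50) + 150) + 50.
    call (with_main e) 11 [enc_rankings vs, enc_unary (Suc k), enc_ranking cs, enc_rankings L] =
    Some (enc_rankings (fold (extend (good vs (Suc k))) cs L), t)"
proof (induction cs arbitrary: L)
  case Nil
  show ?case by (subst call_with_main) (simp add: enumerate_body_def)
next
  case (Cons c cs)
  let ?L = "extend (good vs (Suc k)) c L"
  obtain t1 where t1: "t1 \<le> length L * (inserts_time N + 50) + 50"
    "call (with_main e) 10 [enc_rankings vs, enc_unary (Suc k), enc_nat c, enc_rankings L, Atom] =
      Some (enc_rankings ?L, t1)"
    using call_extend[OF assms, of c L e "Suc k" "[]"] Cons.prems by fastforce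
  have L: "\<forall>l\<in>set ?L. length l + length cs \<le> N \<and> (\<forall>y\<in>set l. small N y)"
    using Cons.prems by (auto simp: extend_def length_inserts_elem set_inserts_elem)
  obtain t2 where t2: "t2 \<le> length cs * (2 ^ k * (inserts_time N + 50) + 150) + 50"
    "call (with_main e) 11 [enc_rankings vs, enc_unary (Suc k), enc_ranking cs, enc_rankings ?L] =
      Some (enc_rankings (fold (extend (good vs (Suc k))) cs ?L), t2)"
    using Cons.IH[OF bounded_family_extend[OF Cons.prems(1)] _ L] Cons.prems by auto
  have "t1 \<le> 2 ^ k * (inserts_time N + 50) + 50"
    using mult_le_mono1[OF length_bounded_family[OF Cons.prems(1)], of "inserts_time N + 50"] t1(1)
    by linarith
  with t1(2) t2 show ?case
    by (subst call_with_main) (auto simp: enumerate_body_def)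
qed

text \<open>\<open>Pair Atom Atom\<close> is the code of \<open>[[]]\<close>: the enumeration starts
  from the empty ranking.\<close>

lemma call_enumeration:
  assumes "fits N vs" "\<forall>c\<in>set cs. small N c" "length cs \<le> N"
  shows "\<exists>t\<le>2 ^ k * enumerate_time N.
    call (with_main e) 11 [enc_rankings vs, Pair Atom (enc_unary k), enc_ranking cs,
      Pair Atom Atom] =
    Some (enc_rankings (enumeration vs k cs), t)"
proof -
  obtain t where t: "t \<le> length cs * (2 ^ k * (inserts_time N + 50) + 150) + 50"
    "call (with_main e) 11 [enc_rankings vs, Pair Atom (enc_unary k), enc_ranking cs,
      Pair Atom Atom] =
    Some (enc_rankings (enumeration vs k cs), t)"
    using call_enumerate[OF assms(1) bounded_family_Nil, of cs k e] assms
    by (auto simp: enumeration_def)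
  note t(1)
  also have "length cs * (2 ^ k * (inserts_time N + 50) + 150) + 50 \<le>
      N * (2 ^ k * (inserts_time N + 50) + 2 ^ k * 150) + 2 ^ k * 50"
    using assms(3) by (intro add_mono mult_mono) auto
  also have "\<dots> = 2 ^ k * enumerate_time N"
    by (simp add: enumerate_time_def algebra_simps)
  finally show ?thesis using t(2) by blast
qed

text \<open>The cost of decrementing is measured by the number of bits because \<open>size (enc_nat n)\<close> is not
  monotone in \<open>n\<close>: only the bits 1 contribute an inner node of their own.\<close>
fun bit_length :: "nat \<Rightarrow> nat" where
  "bit_length n = (if n = 0 then 0 else Suc (bit_length (n div 2)))"

declare bit_length.simps [simp del]

lemma bit_length_simps:
  "bit_length 0 = 0" "n > 0 \<Longrightarrow> bit_length n = Suc (bit_length (n div 2))"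
  by (simp_all add: bit_length.simps[of n] bit_length.simps[of 0])

lemma bit_length_mono: "m \<le> n \<Longrightarrow> bit_length m \<le> bit_length n"
proof (induction n arbitrary: m rule: less_induct)
  case (less n)
  show ?case
  proof (cases "m = 0")
    case False
    then show ?thesis
      using less.IH[of "n div 2" "m div 2"] less.prems by (simp add: bit_length_simps div_le_mono)
  qed (simp add: bit_length_simps)
qed

lemma bit_length_le_size: "bit_length n \<le> size (enc_nat n)"
proof (induction n rule: less_induct)
  case (less n)
  then show ?case
    using less.IH[of "n div 2"] by (cases "n = 0") (auto simp: bit_length_simps enc_nat_pos intro: trans_le_add2)
qed

lemma call_pred:
  "n > 0 \<Longrightarrow> \<exists>t\<le>50 * bit_length n.
    call (with_main e) 12 [enc_nat n] = Some (enc_nat (n - 1), t)"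
proof (induction n rule: less_induct)
  case (less n)
  show ?case
  proof (cases "odd n")
    case True
    \<comment> \<open>For \<open>n = 1\<close> the top bit disappears; a remaining zero bit would
      not be a valid code.\<close>
    then have "enc_nat (n - 1) = (if n div 2 = 0 then Atom else Pair Atom (enc_nat (n div 2)))"
      using less.prems by (cases "n = 1") (auto simp: enc_nat_pos enc_bool_def elim!: oddE)
    with True show ?thesis using less.prems
      by (subst call_with_main)
        (auto simp: pred_body_def enc_nat_pos[OF less.prems] enc_bool_def bit_length_simps)
  next
    case False
    then have h: "n div 2 < n" "n div 2 > 0" using less.prems by auto
    have "n - 1 > 0" "odd (n - 1)" "(n - 1) div 2 = n div 2 - 1"
      using False h by (auto elim!: evenE)
    then have "enc_nat (n - 1) = Pair (Pair Atom Atom) (enc_nat (n div 2 - 1))"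
      by (simp add: enc_nat_pos enc_bool_def)
    moreover obtain t where "t \<le> 50 * bit_length (n div 2)"
      "call (with_main e) 12 [enc_nat (n div 2)] = Some (enc_nat (n div 2 - 1), t)"
      using less.IH[OF h] by blast
    ultimately show ?thesis using False less.prems
      by (subst call_with_main)
        (auto simp: pred_body_def enc_nat_pos[OF less.prems] enc_bool_def bit_length_simps)
  qed
qed

section \<open>Truncation, unary numbers and the search for the optimum\<close>

lemma call_take:
  "bit_length r \<le> N \<Longrightarrow> \<exists>t\<le>length L * (50 * N + 50) + 50.
    call (with_main e) 13 [enc_list f L, enc_nat r] = Some (enc_list f (take r L), t)"
proof (induction L arbitrary: r)
  case Nil
  show ?case by (subst call_with_main) (simp add: take_body_def)
next
  case (Cons l L)
  show ?case
  proof (cases "r = 0")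
    case True
    then show ?thesis by (subst call_with_main) (simp add: take_body_def)
  next
    case False
    obtain t1 where "t1 \<le> 50 * bit_length r"
      "call (with_main e) 12 [enc_nat r] = Some (enc_nat (r - 1), t1)"
      using call_pred[of r e] False by auto
    moreover obtain t2 where "t2 \<le> length L * (50 * N + 50) + 50"
      "call (with_main e) 13 [enc_list f L, enc_nat (r - 1)] =
        Some (enc_list f (take (r - 1) L), t2)"
      using Cons.IH[of "r - 1"] Cons.prems bit_length_mono[of "r - 1" r] by auto
    ultimately show ?thesis using False Cons.prems
      by (subst call_with_main) (auto simp: take_body_def take_Cons')
  qed
qed

lemma call_double:
  "\<exists>t\<le>50 * n + 50. call (with_main e) 15 [enc_unary n, enc_unary m] = Some (enc_unary (2 * n + m), t)"
proof (induction n)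
  case 0
  show ?case by (subst call_with_main) (simp add: double_body_def)
next
  case (Suc n)
  then obtain t where "t \<le> 50 * n + 50"
    "call (with_main e) 15 [enc_unary n, enc_unary m] = Some (enc_unary (2 * n + m), t)"
    by blast
  then show ?case by (subst call_with_main) (auto simp: double_body_def)
qed

text \<open>The last doubling is linear in \<open>n\<close>, and the earlier ones form a geometric
  series below it.\<close>

lemma call_unary:
  "\<exists>t\<le>200 * n + 50. call (with_main e) 14 [enc_nat n] = Some (enc_unary n, t)"
proof (induction n rule: less_induct)
  case (less n)
  show ?case
  proof (cases "n = 0")
    case True
    then show ?thesis by (subst call_with_main) (simp add: unary_body_def)
  next
    case False
    obtain t1 where t1: "t1 \<le> 200 * (n div 2) + 50"
      "call (with_main e) 14 [enc_nat (n div 2)] = Some (enc_unary (n div 2), t1)"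
      using less[of "n div 2"] False by auto
    obtain t2 where t2: "t2 \<le> 50 * (n div 2) + 50"
      "call (with_main e) 15 [enc_unary (n div 2), enc_unary (n mod 2)] = Some (enc_unary n, t2)"
      using call_double[of "n div 2" e "n mod 2"] by auto
    have "t1 + t2 + 30 \<le> 200 * n + 50"
      using t1(1) t2(1) False by (cases "n = 1") auto
    with t1 t2 False show ?thesis
      by (subst call_with_main)
        (auto simp: unary_body_def enc_nat_pos enc_bool_def odd_iff_mod_2_eq_one even_iff_mod_2_eq_zero)
  qed
qed

lemma fifty_le_power: "(50 :: nat) \<le> 2 ^ k * 100"
  by (induction k) auto

text \<open>The difference of powers is the sum of \<open>2 ^ j\<close> over the remaining rounds,
  with \<open>j\<close> from \<open>k\<close> to \<open>K\<close>.\<close>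

lemma call_search:
  assumes "fits N vs" "\<forall>c\<in>set cs. small N c" "length cs \<le> N"
    and K: "enumeration vs K cs \<noteq> []" "\<forall>k<K. enumeration vs k cs = []"
  shows "k \<le> K \<Longrightarrow> \<exists>t\<le>(2 ^ Suc K - 2 ^ k) * (enumerate_time N + 100).
    call (with_main e) 16 [Atom, enc_rankings vs, enc_unary k, enc_ranking cs] =
    Some (enc_rankings (enumeration vs K cs), t)"
proof (induction "K - k" arbitrary: k)
  case 0
  then have [simp]: "k = K" by simp
  obtain t where t: "t \<le> 2 ^ K * enumerate_time N"
    "call (with_main e) 11 [enc_rankings vs, Pair Atom (enc_unary K), enc_ranking cs,
      Pair Atom Atom] =
    Some (enc_rankings (enumeration vs K cs), t)"
    using call_enumeration[OF assms(1-3)] by blast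
  have "call (with_main e) 16 [enc_rankings (enumeration vs K cs), enc_rankings vs,
      enc_unary (Suc K), enc_ranking cs] = Some (enc_rankings (enumeration vs K cs), 3)"
    using K(1) by (subst call_with_main) (simp add: search_body_def)
  moreover have "t + 50 \<le> 2 ^ K * (enumerate_time N + 100)"
    unfolding distrib_left using t(1) by (intro add_mono) (simp_all add: fifty_le_power)
  ultimately show ?case using t(2) by (subst call_with_main) (auto simp: search_body_def)
next
  case (Suc x)
  then have k: "k < K" "x = K - Suc k" "Suc k \<le> K" by auto
  obtain t1 where t1: "t1 \<le> 2 ^ k * enumerate_time N"
    "call (with_main e) 11 [enc_rankings vs, Pair Atom (enc_unary k), enc_ranking cs,
      Pair Atom Atom] = Some (Atom, t1)"
    using call_enumeration[OF assms(1-3), of k e] K(2) k(1) by auto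
  obtain t2 where t2: "t2 \<le> (2 ^ Suc K - 2 ^ Suc k) * (enumerate_time N + 100)"
    "call (with_main e) 16 [Atom, enc_rankings vs, enc_unary (Suc k), enc_ranking cs] =
    Some (enc_rankings (enumeration vs K cs), t2)"
    using Suc.hyps(1)[OF k(2,3)] by blast
  have "t1 + 50 \<le> 2 ^ k * (enumerate_time N + 100)"
    unfolding distrib_left using t1(1) by (intro add_mono) (simp_all add: fifty_le_power)
  moreover have "(2 ^ Suc K - 2 ^ k) = (2 ^ Suc K - 2 ^ Suc k) + (2 ^ k :: nat)"
    using power_increasing[of "Suc k" "Suc K" "2::nat"] k(1) by simp
  ultimately have "t1 + t2 + 50 \<le> (2 ^ Suc K - 2 ^ k) * (enumerate_time N + 100)"
    using t2(1) by (simp only: distrib_right)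
  with t1(2) t2(2) show ?case by (subst call_with_main) (auto simp: search_body_def)
qed

section \<open>Rankings as lists\<close>

lemma list_order_Nil: "list_order [] = {}"
  by (simp add: list_order_def)

lemma list_order_Cons: "list_order (a # xs) = {(a, y) | y. y \<in> set (a # xs)} \<union> list_order xs"
proof
  show "list_order (a # xs) \<subseteq> {(a, y) | y. y \<in> set (a # xs)} \<union> list_order xs"
  proof
    fix p assume "p \<in> list_order (a # xs)"
    then obtain i j where p: "p = ((a # xs) ! i, (a # xs) ! j)" "i \<le> j" "j < length (a # xs)"
      by (auto simp: list_order_def)
    show "p \<in> {(a, y) | y. y \<in> set (a # xs)} \<union> list_order xs"
    proof (cases i)
      case 0
      then show ?thesis using p nth_mem[of j "a # xs"] by auto
    next
      case (Suc i')
      then obtain j' where "j = Suc j'" using p(2) by (cases j) auto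
      with p Suc show ?thesis by (auto simp: list_order_def)
    qed
  qed
next
  have "(a, y) \<in> list_order (a # xs)" if "y \<in> set (a # xs)" for y
  proof -
    from that have "\<exists>j<length (a # xs). (a # xs) ! j = y" by (simp only: in_set_conv_nth)
    then obtain j where "j < length (a # xs)" "(a # xs) ! j = y" by (elim exE conjE)
    then have "(a, y) = ((a # xs) ! 0, (a # xs) ! j) \<and> 0 \<le> j \<and> j < length (a # xs)"
      by simp
    then show ?thesis unfolding list_order_def by blast
  qed
  moreover have "list_order xs \<subseteq> list_order (a # xs)"
  proof
    fix p assume "p \<in> list_order xs"
    then obtain i j where "p = (xs ! i, xs ! j)" "i \<le> j" "j < length xs"
      by (auto simp: list_order_def)
    then have "p = ((a # xs) ! Suc i, (a # xs) ! Suc j) \<and> Suc i \<le> Suc j \<and> Suc j < length (a # xs)"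
      by simp
    then show "p \<in> list_order (a # xs)" unfolding list_order_def by blast
  qed
  ultimately show "{(a, y) | y. y \<in> set (a # xs)} \<union> list_order xs \<subseteq> list_order (a # xs)"
    by auto
qed

lemma list_order_subset: "list_order xs \<subseteq> set xs \<times> set xs"
  by (auto simp: list_order_def)

lemma linear_order_list_order: "distinct xs \<Longrightarrow> linear_order_on (set xs) (list_order xs)"
proof (induction xs)
  case Nil
  then show ?case by (simp add: list_order_Nil)
next
  case (Cons a xs)
  with list_order_subset[of xs] show ?case
    by (auto simp: list_order_Cons order_on_defs refl_on_def total_on_def
        intro!: transI antisymI dest: transD antisymD)
qed

text \<open>By antisymmetry the first candidate is determined by the order, and removing its pairs
  leaves the order of the tail.\<close>

lemma inj_list_order: "distinct xs \<Longrightarrow> distinct ys \<Longrightarrow> list_order xs = list_order ys \<Longrightarrow> xs = ys"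
proof (induction xs arbitrary: ys)
  case Nil
  then show ?case by (cases ys) (auto simp: list_order_Nil list_order_Cons)
next
  case (Cons a xs)
  show ?case
  proof (cases ys)
    case Nil
    with Cons.prems show ?thesis by (auto simp: list_order_Nil list_order_Cons)
  next
    case ys: (Cons b zs)
    have Field: "set (a # xs) = Field (list_order (a # xs))" "set ys = Field (list_order ys)"
      by (auto simp: Field_def list_order_Cons ys dest: subsetD[OF list_order_subset])
    then have "b \<in> set (a # xs)" "a \<in> set ys" using Cons.prems(3) ys by auto
    then have "(a, b) \<in> list_order (a # xs)" "(b, a) \<in> list_order ys"
      by (auto simp: ys list_order_Cons)
    then have "(a, b) \<in> list_order (a # xs)" "(b, a) \<in> list_order (a # xs)"
      using Cons.prems(3) by simp_all
    then have ab: "a = b"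
      using linear_order_list_order[OF Cons.prems(1)] by (auto simp: order_on_defs dest: antisymD)
    have "list_order xs = {p \<in> list_order (a # xs). fst p \<noteq> a}"
      "list_order zs = {p \<in> list_order ys. fst p \<noteq> a}"
      using Cons.prems(1,2) ys ab list_order_subset[of xs] list_order_subset[of zs]
      by (auto simp: list_order_Cons)
    then have "list_order xs = list_order zs" using Cons.prems(3) by simp
    with Cons ys ab show ?thesis by auto
  qed
qed

text \<open>Sorting by the number of predecessors lists \<open>C\<close> in the order
  \<open>R\<close>.\<close>

lemma linear_order_on_imp_list_order:
  assumes "finite C" "linear_order_on C R"
  obtains xs where "distinct xs" "set xs = C" "list_order xs = R"
proof -
  define f where "f x = card {y. (y, x) \<in> R}" for x
  have R: "R \<subseteq> C \<times> C" "refl_on C R" "trans R" "antisym R" "total_on C R"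
    using assms(2) by (auto simp: order_on_defs)
  have fin: "finite {y. (y, x) \<in> R}" for x
    using R(1) by (intro finite_subset[OF _ assms(1)]) auto
  have le: "(x, y) \<in> R" if xy: "x \<in> C" "y \<in> C" "f x \<le> f y" for x y
  proof (rule ccontr)
    assume n: "(x, y) \<notin> R"
    then have yx: "(y, x) \<in> R" "x \<noteq> y"
      using xy R by (cases "x = y"; auto simp: total_on_def refl_on_def)+
    have "{z. (z, y) \<in> R} \<subset> {z. (z, x) \<in> R}"
      using yx n R(2,3) xy by (auto dest: transD refl_onD)
    then have "f y < f x" unfolding f_def by (intro psubset_card_mono fin)
    with xy show False by simp
  qed
  obtain l where l: "set l = C" "distinct l"
    using finite_distinct_list[OF assms(1)] by blast
  define xs where "xs = sort_key f l"
  have xs: "set xs = C" "distinct xs" "sorted (map f xs)"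
    using l by (simp_all add: xs_def)
  have "list_order xs \<subseteq> R"
    using xs(1) sorted_nth_mono[OF xs(3)] by (fastforce simp: list_order_def intro!: le)
  \<comment> \<open>A total order contained in an antisymmetric one on the same set equals
    it.\<close>
  moreover have "R \<subseteq> list_order xs"
  proof
    fix p assume p: "p \<in> R"
    then obtain x y where xy: "p = (x, y)" "x \<in> set xs" "y \<in> set xs" using R(1) xs(1) by auto
    from linear_order_list_order[OF xs(2)] have "(x, y) \<in> list_order xs \<or> (y, x) \<in> list_order xs"
      using xy by (cases "x = y") (auto simp: order_on_defs total_on_def dest: refl_onD)
    then show "p \<in> list_order xs"
      using p xy \<open>list_order xs \<subseteq> R\<close> R(4) by (auto dest: antisymD)
  qed
  ultimately show thesis using that xs by blast
qed

section \<open>Kendall-Tau distance and score on lists\<close>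

lemma before_list_order_Cons:
  "a \<notin> set xs \<Longrightarrow>
    before (list_order (a # xs)) x y \<longleftrightarrow> x = a \<and> y \<in> set xs \<or> before (list_order xs) x y"
  by (auto simp: before_def list_order_Cons)

lemma before_list_order_in_set: "before (list_order xs) x y \<Longrightarrow> x \<in> set xs \<and> y \<in> set xs"
  using list_order_subset[of xs] by (auto simp: before_def)

lemma bef_iff_before:
  "distinct v \<Longrightarrow> x \<noteq> y \<Longrightarrow> x \<in> set v \<Longrightarrow> y \<in> set v \<Longrightarrow> bef v x y \<longleftrightarrow> before (list_order v) x y"
proof (induction v)
  case (Cons a v)
  then show ?case
    by (auto simp: before_list_order_Cons dest: before_list_order_in_set)
qed simp

lemma sorted_wrt_iff_before:
  "distinct q \<Longrightarrow> sorted_wrt P q \<longleftrightarrow> (\<forall>x y. before (list_order q) x y \<longrightarrow> P x y)"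
proof (induction q)
  case Nil
  then show ?case by (simp add: before_def list_order_Nil)
next
  case (Cons a q)
  then show ?case by (auto simp: before_list_order_Cons)
qed

lemma before_linear_order:
  assumes "linear_order_on C R"
  shows "before R x y \<Longrightarrow> \<not> before R y x"
    and "x \<in> C \<Longrightarrow> y \<in> C \<Longrightarrow> x \<noteq> y \<Longrightarrow> before R x y \<or> before R y x"
    and "before R x y \<Longrightarrow> before R y z \<Longrightarrow> before R x z"
proof -
  have R: "antisym R" "trans R" "total_on C R" using assms by (auto simp: order_on_defs)
  show "before R x y \<Longrightarrow> \<not> before R y x"
    using R(1) by (auto simp: before_def dest: antisymD)
  show "x \<in> C \<Longrightarrow> y \<in> C \<Longrightarrow> x \<noteq> y \<Longrightarrow> before R x y \<or> before R y x"
    using R(3) by (auto simp: before_def total_on_def)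
  show "before R x y \<Longrightarrow> before R y z \<Longrightarrow> before R x z"
    unfolding before_def using R(1,2) by (meson antisymD transD)
qed

text \<open>Pairs ordered differently either contain \<open>a\<close> or lie within
  \<open>q\<close>. As the list starts with \<open>a\<close>, the former correspond to the
  candidates that \<open>S\<close> places before \<open>a\<close>.\<close>

lemma kt_dist_list_order_Cons:
  assumes "distinct (a # q)"
  shows "kt_dist (list_order (a # q)) S =
    length (filter (\<lambda>y. before S y a) q) + kt_dist (list_order q) S"
proof -
  let ?A = "(\<lambda>y. {a, y}) ` {y \<in> set q. before S y a}"
  let ?B = "{{x, y} | x y. before (list_order q) x y \<and> before S y x}"
  have "{{x, y} | x y. before (list_order (a # q)) x y \<and> before S y x} = ?A \<union> ?B"
    using assms by (auto simp: before_list_order_Cons)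
  moreover have "?A \<inter> ?B = {}"
    using assms by (auto dest!: before_list_order_in_set simp: doubleton_eq_iff)
  moreover have "?B \<subseteq> Pow (set q)"
    by (auto dest: before_list_order_in_set)
  then have "finite ?B" by (rule finite_subset) simp
  moreover have "card ?A = length (filter (\<lambda>y. before S y a) q)"
  proof -
    have "inj_on (\<lambda>y. {a, y}) {y \<in> set q. before S y a}"
      by (auto simp: inj_on_def doubleton_eq_iff)
    then have "card ?A = card (set (filter (\<lambda>y. before S y a) q))"
      by (simp add: card_image)
    then show ?thesis using assms by (simp add: distinct_card del: set_filter)
  qed
  ultimately show ?thesis by (simp add: kt_dist_def card_Un_disjoint)
qed

text \<open>Double counting: the program counts votes for each pair, the Kendall-Tau distance counts
  pairs for each vote.\<close>

lemma sum_list_opposed: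
  "sum_list (map (opposed vs x) q) = (\<Sum>v\<leftarrow>vs. length (filter (\<lambda>y. bef v y x) q))"
proof (induction q)
  case Nil
  show ?case by (induction vs) auto
next
  case (Cons y q)
  have "opposed vs x y = (\<Sum>v\<leftarrow>vs. if bef v y x then 1 else 0)"
    by (induction vs) (auto simp: opposed_def)
  then show ?case
    by (simp add: Cons sum_list_addf[symmetric] if_distrib cong: if_cong)
       (rule arg_cong[where f = sum_list], auto)
qed

text \<open>An inclusion in \<open>C\<close>, instead of an equation, lets the induction pass to
  suffixes.\<close>

lemma score_eq_kt_dist:
  assumes "\<forall>v\<in>set vs. lists_ranking C v"
  shows "distinct q \<Longrightarrow> set q \<subseteq> C \<Longrightarrow>
    score vs q = (\<Sum>v\<leftarrow>vs. kt_dist (list_order q) (list_order v))"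
proof (induction q)
  case Nil
  show ?case by (induction vs) (auto simp: kt_dist_def list_order_Nil before_def)
next
  case (Cons a q)
  have "filter (\<lambda>y. bef v y a) q = filter (\<lambda>y. before (list_order v) y a) q" if "v \<in> set vs" for v
    using Cons.prems that assms
    by (intro filter_cong bef_iff_before) (auto simp: lists_ranking_def)
  then have "map (\<lambda>v. length (filter (\<lambda>y. bef v y a) q)) vs =
      map (\<lambda>v. length (filter (\<lambda>y. before (list_order v) y a) q)) vs"
    by simp
  with Cons show ?case
    by (simp add: sum_list_opposed kt_dist_list_order_Cons sum_list_addf del: map_eq_conv)
qed

lemma opposed_mono:
  "(\<And>v. v \<in> set vs \<Longrightarrow> bef v b x \<Longrightarrow> bef v b' x') \<Longrightarrow> opposed vs x b \<le> opposed vs x' b'"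
  by (induction vs) (auto simp: opposed_def le_SucI)

lemma score_append:
  "score vs (xs @ ys) =
    score vs xs + score vs ys + (\<Sum>x\<leftarrow>xs. sum_list (map (opposed vs x) ys))"
  by (induction xs) auto

text \<open>The offending pair need not be adjacent, whence the block \<open>B\<close>, which the
  exchange argument has to control.\<close>

lemma not_sorted_wrt_decomp:
  "\<not> sorted_wrt P q \<Longrightarrow> \<exists>A y B x D. q = A @ y # B @ x # D \<and> \<not> P y x"
proof (induction q)
  case (Cons a q)
  show ?case
  proof (cases "sorted_wrt P q")
    case True
    then obtain x where "x \<in> set q" "\<not> P a x" using Cons.prems by auto
    then show ?thesis by (metis append_Nil split_list)
  next
    case False
    then show ?thesis using Cons.IH by (metis append_Cons)
  qed
qed simp

section \<open>Correctness for a fixed profile\<close>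

context
  fixes C :: "nat set" and \<Pi> :: "nat rel multiset" and cs :: "nat list" and vs :: "nat list list"
  assumes profile: "profile C \<Pi>" and lists: "lists_profile C \<Pi> cs vs"
begin

lemma votes: "finite C" "vs \<noteq> []" "\<forall>v\<in>set vs. lists_ranking C v" "\<Pi> = mset (map list_order vs)"
  using profile lists by (auto simp: profile_def lists_profile_def)

lemma linear_order_ranking: "lists_ranking C q \<Longrightarrow> linear_order_on C (list_order q)"
  using linear_order_list_order[of q] by (auto simp: lists_ranking_def)

lemma rankings_image: "{Q. linear_order_on C Q} = list_order ` {q. lists_ranking C q}"
proof
  show "{Q. linear_order_on C Q} \<subseteq> list_order ` {q. lists_ranking C q}"
  proof
    fix Q assume "Q \<in> {Q. linear_order_on C Q}"
    then obtain q where "distinct q" "set q = C" "list_order q = Q"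
      using linear_order_on_imp_list_order[OF votes(1)] by blast
    then show "Q \<in> list_order ` {q. lists_ranking C q}" by (auto simp: lists_ranking_def)
  qed
qed (auto intro: linear_order_ranking)

lemma inj_on_rankings: "inj_on list_order {q. lists_ranking C q}"
  by (auto simp: inj_on_def lists_ranking_def intro: inj_list_order)

lemma kemeny_score_eq: "lists_ranking C q \<Longrightarrow> kemeny_score \<Pi> (list_order q) = score vs q"
proof -
  assume q: "lists_ranking C q"
  have "kemeny_score \<Pi> (list_order q) =
      sum_mset (mset (map (\<lambda>v. kt_dist (list_order q) (list_order v)) vs))"
    by (simp add: kemeny_score_def votes(4) image_mset.compositionality comp_def)
  also have "\<dots> = score vs q"
    using score_eq_kt_dist[OF votes(3), of q] q
    unfolding sum_mset_sum_list lists_ranking_def by simp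
  finally show ?thesis .
qed

lemma bef_vote:
  "v \<in> set vs \<Longrightarrow> x \<in> C \<Longrightarrow> y \<in> C \<Longrightarrow> x \<noteq> y \<Longrightarrow> bef v x y \<longleftrightarrow> before (list_order v) x y"
  using votes(3) by (intro bef_iff_before) (auto simp: lists_ranking_def)

lemma linear_order_vote: "v \<in> set vs \<Longrightarrow> linear_order_on C (list_order v)"
  using votes(3) linear_order_ranking by blast

text \<open>By totality, for different candidates \<open>x\<close> before \<open>y\<close> lacks
  support exactly if all votes place \<open>y\<close> before \<open>x\<close>.\<close>

lemma respects_unanimity_iff:
  assumes "lists_ranking C q"
  shows "respects_unanimity C \<Pi> (list_order q) \<longleftrightarrow> sorted_wrt (supported vs) q"
proof -
  note q = linear_order_ranking[OF assms]
  have d: "distinct q" "set q = C" using assms by (auto simp: lists_ranking_def)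
  show ?thesis
  proof
    assume r: "respects_unanimity C \<Pi> (list_order q)"
    have "supported vs x y" if xy: "before (list_order q) x y" for x y
    proof (rule ccontr)
      assume n: "\<not> supported vs x y"
      have C: "x \<in> C" "y \<in> C" "x \<noteq> y"
        using before_list_order_in_set[OF xy] d xy by (auto simp: before_def)
      have "before (list_order v) y x" if "v \<in> set vs" for v
        using n that C bef_vote[of v x y] before_linear_order(2)[OF linear_order_vote, of v x y]
        by (auto simp: supported_def)
      then have "before (list_order q) y x"
        using r C by (auto simp: respects_unanimity_def votes(4))
      with before_linear_order(1)[OF q xy] show False by simp
    qed
    then show "sorted_wrt (supported vs) q" by (simp add: sorted_wrt_iff_before d)
  next
    assume s: "sorted_wrt (supported vs) q"
    have "before (list_order q) x y"
      if xy: "x \<in> C" "y \<in> C" "\<forall>v\<in>set vs. before (list_order v) x y" for x y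
    proof (rule ccontr)
      assume n: "\<not> before (list_order q) x y"
      \<comment> \<open>Read off from a vote, which exists because a profile is nonempty.\<close>
      have "x \<noteq> y" using votes(2) xy(3) by (cases vs) (auto simp: before_def)
      then have "before (list_order q) y x" using n before_linear_order(2)[OF q, of x y] xy by blast
      then have "supported vs y x" using s by (simp add: sorted_wrt_iff_before d)
      then obtain v where "v \<in> set vs" "before (list_order v) y x"
        using bef_vote xy \<open>x \<noteq> y\<close> by (auto simp: supported_def)
      with xy before_linear_order(1)[OF linear_order_vote] show False by blast
    qed
    then show "respects_unanimity C \<Pi> (list_order q)"
      by (simp add: respects_unanimity_def votes(4))
  qed
qed

lemma enumeration_rankings:
  "distinct (enumeration vs k cs)"
  "set (enumeration vs k cs) = {q. lists_ranking C q \<and> good vs (Suc k) q}"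
  using enumeration_spec[of cs vs k] lists by (auto simp: lists_profile_def lists_ranking_def)

lemma card_image_rankings: "Q \<subseteq> {q. lists_ranking C q} \<Longrightarrow> card (list_order ` Q) = card Q"
  using inj_on_rankings by (intro card_image) (blast intro: inj_on_subset)

lemma output_take:
  assumes "distinct L" "set L \<subseteq> {q. lists_ranking C q}"
  obtains Rs where "output_rankings C Rs (enc_rankings (take r L))"
    "distinct Rs" "length Rs = min r (card (list_order ` set L))" "set Rs \<subseteq> list_order ` set L"
proof
  let ?Rs = "map list_order (take r L)"
  show "output_rankings C ?Rs (enc_rankings (take r L))"
    using assms(2) set_take_subset[of r L] unfolding output_rankings_def by blast
  have "inj_on list_order (set (take r L))"
    using assms(2) set_take_subset[of r L] by (intro inj_on_subset[OF inj_on_rankings]) auto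
  then show "distinct ?Rs" using assms(1) by (simp add: distinct_map)
  show "length ?Rs = min r (card (list_order ` set L))"
    using assms by (simp add: card_image_rankings distinct_card min.commute)
  show "set ?Rs \<subseteq> list_order ` set L" using set_take_subset[of r L] by auto
qed

lemma distinct_kemeny_output_enumeration:
  "distinct_kemeny_output (C, \<Pi>, k, r) (enc_rankings (take r (enumeration vs k cs)))"
proof -
  let ?L = "enumeration vs k cs"
  have "list_order ` set ?L = {Q \<in> kemeny_at_most C \<Pi> k. respects_unanimity C \<Pi> Q}"
  proof -
    have "{Q \<in> kemeny_at_most C \<Pi> k. respects_unanimity C \<Pi> Q} =
        {Q \<in> list_order ` {q. lists_ranking C q}.
          kemeny_score \<Pi> Q \<le> k \<and> respects_unanimity C \<Pi> Q}"
      by (auto simp: kemeny_at_most_def rankings_image[symmetric])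
    also have "\<dots> = list_order ` {q. lists_ranking C q \<and> good vs (Suc k) q}"
      by (auto simp: kemeny_score_eq respects_unanimity_iff good_def less_Suc_eq_le)
    finally show ?thesis by (simp add: enumeration_rankings)
  qed
  moreover obtain Rs where "output_rankings C Rs (enc_rankings (take r ?L))"
    "distinct Rs" "length Rs = min r (card (list_order ` set ?L))" "set Rs \<subseteq> list_order ` set ?L"
    using output_take[OF enumeration_rankings(1)] enumeration_rankings(2) by blast
  ultimately show ?thesis by (auto simp: distinct_kemeny_def)
qed

text \<open>If every vote places \<open>x\<close> before \<open>y\<close>, exchanging the two in a ranking that places \<open>y\<close> first
  lowers its score: no vote gains a disagreement about a candidate in between.\<close>
lemma score_swap_less:
  assumes q: "lists_ranking C (A @ y # B @ x # D)" and n: "\<not> supported vs y x"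
  shows "score vs (A @ x # B @ y # D) < score vs (A @ y # B @ x # D)"
proof -
  have xy: "x \<in> C" "y \<in> C" "x \<noteq> y" "\<And>b. b \<in> set B \<Longrightarrow> b \<in> C \<and> b \<noteq> x \<and> b \<noteq> y"
    using q by (auto simp: lists_ranking_def)
  have v: "before (list_order v) x y" if "v \<in> set vs" for v
    using n that xy bef_vote[of v y x] before_linear_order(2)[OF linear_order_vote, of v x y]
    by (auto simp: supported_def)
  \<comment> \<open>Transitivity in every vote: \<open>b\<close> before \<open>x\<close> gives
    \<open>b\<close> before \<open>y\<close>, and \<open>y\<close> before \<open>b\<close> gives
    \<open>x\<close> before \<open>b\<close>.\<close>
  have B: "opposed vs x b \<le> opposed vs y b" "opposed vs b y \<le> opposed vs b x"
    if b: "b \<in> set B" for b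
    using xy(1-3) xy(4)[OF b] v bef_vote before_linear_order(3)[OF linear_order_vote]
    by (intro opposed_mono; metis)+
  have "opposed vs x y = 0"
    using n by (auto simp: opposed_def supported_def filter_empty_conv)
  \<comment> \<open>The source of strictness: every vote disagrees with \<open>y\<close> before
    \<open>x\<close>, and there is at least one vote.\<close>
  moreover have "opposed vs y x > 0"
    using v bef_vote[of _ x y] xy votes(2) by (cases vs) (auto simp: opposed_def)
  moreover have "sum_list (map (opposed vs x) B) \<le> sum_list (map (opposed vs y) B)"
    "(\<Sum>b\<leftarrow>B. opposed vs b y) \<le> (\<Sum>b\<leftarrow>B. opposed vs b x)"
    using B by (auto intro!: sum_list_mono)
  ultimately show ?thesis
    by (simp add: score_append sum_list_addf)
qed

lemma optimal_imp_sorted_supported: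
  assumes "lists_ranking C q" "\<And>q'. lists_ranking C q' \<Longrightarrow> score vs q \<le> score vs q'"
  shows "sorted_wrt (supported vs) q"
proof (rule ccontr)
  assume "\<not> sorted_wrt (supported vs) q"
  then obtain A y B x D where q: "q = A @ y # B @ x # D" "\<not> supported vs y x"
    using not_sorted_wrt_decomp by blast
  have "lists_ranking C (A @ x # B @ y # D)"
    using assms(1) q(1) by (auto simp: lists_ranking_def)
  then show False using assms score_swap_less[of A y B x D] q by fastforce
qed

section \<open>Optimal rankings\<close>

lemma k_opt_eq: "k_opt C \<Pi> = Min (score vs ` {q. lists_ranking C q})"
  unfolding k_opt_def rankings_image image_image
  by (intro arg_cong[where f = Min] image_cong) (auto simp: kemeny_score_eq)

lemma finite_rankings: "finite {q. lists_ranking C q}"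
  using finite_lists_length_eq[OF votes(1), of "card C"]
  by (rule finite_subset[rotated]) (auto simp: lists_ranking_def distinct_card)

lemma k_opt_le: "lists_ranking C q \<Longrightarrow> k_opt C \<Pi> \<le> score vs q"
  unfolding k_opt_eq using finite_rankings by (intro Min_le) auto

lemma k_opt_attained: "\<exists>q. lists_ranking C q \<and> score vs q = k_opt C \<Pi>"
proof -
  \<comment> \<open>The candidate list of the input is itself a ranking, so the minimum is taken
    over a nonempty set.\<close>
  have "lists_ranking C cs" using lists by (simp add: lists_profile_def lists_ranking_def)
  then have "k_opt C \<Pi> \<in> score vs ` {q. lists_ranking C q}"
    unfolding k_opt_eq using finite_rankings by (intro Min_in) auto
  then show ?thesis by auto
qed

text \<open>At this budget the unanimity filter removes no optimal ranking, and no ranking has a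
  smaller score.\<close>

lemma enumeration_k_opt:
  "set (enumeration vs (k_opt C \<Pi>) cs) = {q. lists_ranking C q \<and> score vs q = k_opt C \<Pi>}"
proof -
  have "good vs (Suc (k_opt C \<Pi>)) q \<longleftrightarrow> score vs q = k_opt C \<Pi>" if q: "lists_ranking C q" for q
    using k_opt_le[OF q] optimal_imp_sorted_supported[OF q] k_opt_le by (auto simp: good_def)
  then show ?thesis unfolding enumeration_rankings by blast
qed

lemma enumeration_search:
  "enumeration vs (k_opt C \<Pi>) cs \<noteq> []" "\<forall>k<k_opt C \<Pi>. enumeration vs k cs = []"
proof -
  show "enumeration vs (k_opt C \<Pi>) cs \<noteq> []"
    using k_opt_attained enumeration_k_opt by force
  have "set (enumeration vs k cs) = {}" if "k < k_opt C \<Pi>" for k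
    using that k_opt_le unfolding enumeration_rankings good_def by fastforce
  then show "\<forall>k<k_opt C \<Pi>. enumeration vs k cs = []" by simp
qed

lemma kemeny_rankings_eq:
  "kemeny_rankings C \<Pi> = list_order ` {q. lists_ranking C q \<and> score vs q = k_opt C \<Pi>}"
proof -
  have "kemeny_rankings C \<Pi> = {Q \<in> list_order ` {q. lists_ranking C q}.
      \<forall>Q'\<in>list_order ` {q. lists_ranking C q}. kemeny_score \<Pi> Q \<le> kemeny_score \<Pi> Q'}"
    unfolding rankings_image[symmetric] by (auto simp: kemeny_rankings_def is_arg_min_linorder)
  also have "\<dots> = list_order ` {q. lists_ranking C q \<and> (\<forall>q'. lists_ranking C q' \<longrightarrow>
      score vs q \<le> score vs q')}"
    by (auto simp: kemeny_score_eq)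
  also have "{q. lists_ranking C q \<and> (\<forall>q'. lists_ranking C q' \<longrightarrow> score vs q \<le> score vs q')} =
      {q. lists_ranking C q \<and> score vs q = k_opt C \<Pi>}"
  proof -
    obtain q0 where "lists_ranking C q0" "score vs q0 = k_opt C \<Pi>" using k_opt_attained by blast
    then show ?thesis using k_opt_le by (auto intro!: antisym)
  qed
  finally show ?thesis .
qed

lemma distinct_opt_kemeny_output_enumeration:
  "distinct_opt_kemeny_output (C, \<Pi>, r) (enc_rankings (take r (enumeration vs (k_opt C \<Pi>) cs)))"
proof -
  let ?L = "enumeration vs (k_opt C \<Pi>) cs"
  obtain Rs where "output_rankings C Rs (enc_rankings (take r ?L))"
    "distinct Rs" "length Rs = min r (card (list_order ` set ?L))" "set Rs \<subseteq> list_order ` set ?L"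
    using output_take[OF enumeration_rankings(1)] enumeration_rankings(2) by blast
  moreover have "list_order ` set ?L = kemeny_rankings C \<Pi>"
    by (simp add: enumeration_k_opt kemeny_rankings_eq)
  ultimately show ?thesis by (auto simp: distinct_opt_kemeny_def)
qed

end

section \<open>The algorithms\<close>

text \<open>Lets introduction rules show that a composed time bound is a polynomial, without
  computing coefficients.\<close>

definition polynomial_fun :: "(nat \<Rightarrow> nat) \<Rightarrow> bool" where
  "polynomial_fun f \<longleftrightarrow> (\<exists>q. \<forall>n. f n = poly q n)"

lemma polynomial_fun_intros:
  "polynomial_fun (\<lambda>n. c)"
  "polynomial_fun (\<lambda>n. n)"
  "polynomial_fun f \<Longrightarrow> polynomial_fun g \<Longrightarrow> polynomial_fun (\<lambda>n. f n + g n)"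
  "polynomial_fun f \<Longrightarrow> polynomial_fun g \<Longrightarrow> polynomial_fun (\<lambda>n. f n * g n)"
proof -
  show "polynomial_fun (\<lambda>n. c)"
    unfolding polynomial_fun_def by (rule exI[of _ "[:c:]"]) simp
  show "polynomial_fun (\<lambda>n. n)"
    unfolding polynomial_fun_def by (rule exI[of _ "[:0, 1:]"]) simp
  show "polynomial_fun f \<Longrightarrow> polynomial_fun g \<Longrightarrow> polynomial_fun (\<lambda>n. f n + g n)"
    unfolding polynomial_fun_def by (metis poly_add)
  show "polynomial_fun f \<Longrightarrow> polynomial_fun g \<Longrightarrow> polynomial_fun (\<lambda>n. f n * g n)"
    unfolding polynomial_fun_def by (metis poly_mult)
qed

lemma polynomial_enumerate_time: "polynomial_fun enumerate_time"
  unfolding enumerate_time_def inserts_time_def pay_time_def row_time_def votes_time_def bef_time_def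
  by (intro polynomial_fun_intros)

lemma length_le_size_enc_list: "length xs \<le> size (enc_list f xs)"
  by (induction xs) auto

lemma size_elem_le_enc_list: "x \<in> set xs \<Longrightarrow> size (f x) \<le> size (enc_list f xs)"
  by (induction xs) auto

lemma input_size_bounds:
  assumes "size (enc_ranking cs) \<le> N" "size (enc_rankings vs) \<le> N"
  shows "fits N vs" "\<forall>c\<in>set cs. small N c" "length cs \<le> N"
proof -
  have "length v \<le> N" if "v \<in> set vs" for v
    using length_le_size_enc_list[of v enc_nat] size_elem_le_enc_list[OF that, of enc_ranking] assms(2)
    by linarith
  then show "fits N vs"
    using length_le_size_enc_list[of vs enc_ranking] assms(2) by (auto simp: fits_def)
  show "\<forall>c\<in>set cs. small N c"
    using size_elem_le_enc_list[of _ cs enc_nat] assms(1) by (auto simp: small_def intro: order_trans)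
  show "length cs \<le> N"
    using length_le_size_enc_list[of cs enc_nat] assms(1) by linarith
qed

definition kemeny_main :: expr where
  "kemeny_main =
     ECall 13
       [ECall 11 [EHd (ETl (EVar 0)), EPair EAtom (ECall 14 [EHd (ETl (ETl (EVar 0)))]),
          EHd (EVar 0), EPair EAtom EAtom],
        EHd (ETl (ETl (ETl (EVar 0))))]"

definition opt_kemeny_main :: expr where
  "opt_kemeny_main =
     ECall 13 [ECall 16 [EAtom, EHd (ETl (EVar 0)), EAtom, EHd (EVar 0)], EHd (ETl (ETl (EVar 0)))]"

text \<open>With the least significant bit first, \<open>2 ^ n\<close> is a one behind
  \<open>n\<close> zero bits. \<open>Atom\<close> is both the zero bit and the unit of unary
  numbers, so \<open>enc_unary n\<close> already supplies these zeros.\<close>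

definition power_main :: expr where
  "power_main = ECall 7 [ECall 14 [EVar 0], EPair (EPair EAtom EAtom) EAtom]"

lemma solves_distinct_kemeny:
  "solves_in_O_star (with_main kemeny_main) distinct_kemeny_input distinct_kemeny_output
    (\<lambda>(C, \<Pi>, k, r). 2 ^ k)"
proof -
  let ?P = "with_main kemeny_main"
  \<comment> \<open>Up to constants, the summands pay for the enumeration, for cutting the result to
    \<open>r\<close> rankings, and for the unary conversion with all fixed overhead.\<close>
  have "polynomial_fun (\<lambda>N. enumerate_time N + 50 * N + 500)"
    by (intro polynomial_fun_intros polynomial_enumerate_time)
  then obtain p where p: "\<And>N. enumerate_time N + 50 * N + 500 = poly p N"
    unfolding polynomial_fun_def by blast
  have "\<exists>y t. runs ?P x y t \<and> distinct_kemeny_output (C, \<Pi>, k, r) y \<and> t \<le> 2 ^ k * poly p (size x)"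
    if inp: "distinct_kemeny_input (C, \<Pi>, k, r) x" for C \<Pi> k r x
  proof -
    obtain cs vs where pr: "profile C \<Pi>" "lists_profile C \<Pi> cs vs"
      and x: "x = enc_list (\<lambda>z. z) [enc_ranking cs, enc_rankings vs, enc_nat k, enc_nat r]"
      using inp by auto
    define N where "N = size x"
    have N: "size (enc_ranking cs) \<le> N" "size (enc_rankings vs) \<le> N" "size (enc_nat r) \<le> N"
      by (auto simp: N_def x)
    note bounds = input_size_bounds[OF N(1,2)]
    have r: "bit_length r \<le> N" using bit_length_le_size N(3) by (rule order_trans)
    let ?L = "enumeration vs k cs"
    obtain t1 where t1: "t1 \<le> 200 * k + 50"
      "call ?P 14 [enc_nat k] = Some (enc_unary k, t1)"
      using call_unary by blast
    obtain t2 where t2: "t2 \<le> 2 ^ k * enumerate_time N"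
      "call ?P 11 [enc_rankings vs, Pair Atom (enc_unary k), enc_ranking cs, Pair Atom Atom] =
        Some (enc_rankings ?L, t2)"
      using call_enumeration[OF bounds] by blast
    obtain t3 where t3: "t3 \<le> length ?L * (50 * N + 50) + 50"
      "call ?P 13 [enc_rankings ?L, enc_nat r] = Some (enc_rankings (take r ?L), t3)"
      using call_take[OF r] by blast
    have "call ?P 0 [x] = Some (enc_rankings (take r ?L), t1 + t2 + t3 + 22)"
      using t1(2) t2(2) t3(2) by (subst call_with_main) (simp add: kemeny_main_def x)
    then have run: "runs ?P x (enc_rankings (take r ?L)) (t1 + t2 + t3 + 22 + 2)"
      by (simp only: runs_iff_call)
    have "length ?L * (50 * N + 50) \<le> 2 ^ k * (50 * N + 50)"
      using length_enumeration by (intro mult_right_mono) auto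
    moreover have "k < 2 ^ k" by simp
    ultimately have "t1 + t2 + t3 + 22 + 2 \<le> 2 ^ k * (enumerate_time N + 50 * N + 500)"
      using t1(1) t2(1) t3(1) unfolding distrib_left by linarith
    then show ?thesis
      using run distinct_kemeny_output_enumeration[OF pr] p[of N] unfolding N_def by metis
  qed
  then show ?thesis unfolding solves_in_O_star_def by (intro exI[of _ p]) auto
qed

lemma solves_distinct_opt_kemeny:
  "solves_in_O_star (with_main opt_kemeny_main) distinct_opt_kemeny_input distinct_opt_kemeny_output
    (\<lambda>(C, \<Pi>, r). 2 ^ k_opt C \<Pi>)"
proof -
  let ?P = "with_main opt_kemeny_main"
  \<comment> \<open>The factor 2 bounds the geometric series of the rounds relative to its last
    term.\<close>
  have "polynomial_fun (\<lambda>N. 2 * enumerate_time N + 50 * N + 500)"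
    by (intro polynomial_fun_intros polynomial_enumerate_time)
  then obtain p where p: "\<And>N. 2 * enumerate_time N + 50 * N + 500 = poly p N"
    unfolding polynomial_fun_def by blast
  have "\<exists>y t. runs ?P x y t \<and> distinct_opt_kemeny_output (C, \<Pi>, r) y \<and>
      t \<le> 2 ^ k_opt C \<Pi> * poly p (size x)"
    if inp: "distinct_opt_kemeny_input (C, \<Pi>, r) x" for C \<Pi> r x
  proof -
    obtain cs vs where pr: "profile C \<Pi>" "lists_profile C \<Pi> cs vs"
      and x: "x = enc_list (\<lambda>z. z) [enc_ranking cs, enc_rankings vs, enc_nat r]"
      using inp by auto
    define N where "N = size x"
    have N: "size (enc_ranking cs) \<le> N" "size (enc_rankings vs) \<le> N" "size (enc_nat r) \<le> N"
      by (auto simp: N_def x)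
    note bounds = input_size_bounds[OF N(1,2)]
    have r: "bit_length r \<le> N" using bit_length_le_size N(3) by (rule order_trans)
    let ?k = "k_opt C \<Pi>"
    let ?L = "enumeration vs ?k cs"
    obtain t1 where t1: "t1 \<le> (2 ^ Suc ?k - 2 ^ 0) * (enumerate_time N + 100)"
      "call ?P 16 [Atom, enc_rankings vs, enc_unary 0, enc_ranking cs] = Some (enc_rankings ?L, t1)"
      using call_search[OF bounds enumeration_search[OF pr] le0] by blast
    obtain t2 where t2: "t2 \<le> length ?L * (50 * N + 50) + 50"
      "call ?P 13 [enc_rankings ?L, enc_nat r] = Some (enc_rankings (take r ?L), t2)"
      using call_take[OF r] by blast
    have "call ?P 0 [x] = Some (enc_rankings (take r ?L), t1 + t2 + 13)"
      using t1(2) t2(2) by (subst call_with_main) (simp add: opt_kemeny_main_def x)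
    then have run: "runs ?P x (enc_rankings (take r ?L)) (t1 + t2 + 13 + 2)"
      by (simp only: runs_iff_call)
    have "length ?L * (50 * N + 50) \<le> 2 ^ ?k * (50 * N + 50)"
      using length_enumeration by (intro mult_right_mono) auto
    moreover have "t1 \<le> 2 ^ ?k * (2 * enumerate_time N + 200)"
      using t1(1) by (simp add: algebra_simps diff_mult_distrib)
    moreover have "1 \<le> (2 :: nat) ^ ?k" by simp
    ultimately have "t1 + t2 + 13 + 2 \<le> 2 ^ ?k * (2 * enumerate_time N + 50 * N + 500)"
      using t2(1) unfolding distrib_left by linarith
    then show ?thesis
      using run distinct_opt_kemeny_output_enumeration[OF pr] p[of N] unfolding N_def by metis
  qed
  then show ?thesis unfolding solves_in_O_star_def by (intro exI[of _ p]) auto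
qed

lemma enc_nat_power2: "enc_nat (2 ^ n) = (Pair Atom ^^ n) (Pair (Pair Atom Atom) Atom)"
  by (induction n) (simp_all add: enc_nat_pos enc_bool_def)

lemma enc_unary_eq_enc_list: "enc_unary n = enc_list (\<lambda>z. z) (replicate n Atom)"
  by (induction n) simp_all

lemma fold_Pair_replicate: "fold Pair (replicate n Atom) s = (Pair Atom ^^ n) s"
  by (induction n arbitrary: s) (simp_all add: funpow_swap1)

lemma computable_power2: "computable (\<lambda>n. 2 ^ n)"
proof -
  let ?P = "with_main power_main"
  have "\<exists>t. runs ?P (enc_nat n) (enc_nat (2 ^ n)) t" for n
  proof -
    obtain t1 where t1: "call ?P 14 [enc_nat n] = Some (enc_unary n, t1)"
      using call_unary by blast
    obtain t2 where t2: "call ?P 7 [enc_unary n, Pair (Pair Atom Atom) Atom] =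
        Some (enc_nat (2 ^ n), t2)"
      using call_rev_append[of "replicate n Atom" power_main "\<lambda>z. z" "Pair (Pair Atom Atom) Atom"]
      unfolding enc_unary_eq_enc_list[symmetric] fold_Pair_replicate enc_nat_power2[symmetric]
      by blast
    have "\<exists>t. call ?P 0 [enc_nat n] = Some (enc_nat (2 ^ n), t)"
      using t1 t2 by (subst call_with_main) (simp add: power_main_def)
    then show ?thesis using runs_iff_call by blast
  qed
  then show ?thesis unfolding computable_def by blast
qed

theorem theorem1:
  shows "(\<exists>P. solves_in_O_star P distinct_kemeny_input distinct_kemeny_output
            (\<lambda>(C, \<Pi>, k, r). 2 ^ k)) \<and>
         fixed_parameter_tractable distinct_kemeny_input distinct_kemeny_output
            (\<lambda>(C, \<Pi>, k, r). k) \<and>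
         (\<exists>P. solves_in_O_star P distinct_opt_kemeny_input distinct_opt_kemeny_output
            (\<lambda>(C, \<Pi>, r). 2 ^ k_opt C \<Pi>))"
proof -
  \<comment> \<open>With \<open>\<lambda>n. 2 ^ n\<close> as the computable function, tractability
    asks for the bound already proved, up to the form of the case expression.\<close>
  have "(\<lambda>i :: nat set \<times> nat rel multiset \<times> nat \<times> nat. 2 ^ (case i of (C, \<Pi>, k, r) \<Rightarrow> k)) =
      (\<lambda>(C, \<Pi>, k, r). 2 ^ k :: nat)"
    by auto
  then have "fixed_parameter_tractable distinct_kemeny_input distinct_kemeny_output
      (\<lambda>(C, \<Pi>, k, r). k)"
    unfolding fixed_parameter_tractable_def using computable_power2 solves_distinct_kemeny by metis
  then show ?thesis using solves_distinct_kemeny solves_distinct_opt_kemeny by blast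
qed

end
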